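(* Let $a,b,z>0$ be real numbers and, for even $m,n$, let $Z_{m,n}$ be the partition function of the monopole-dimer model on the grid graph $Q_{m,n}$ with vertex weights $z$ and edge weights $a,b$. Then the free energy $$F(a,b,z)=\lim_{\substack{m,n\to\infty\\ m,n\text{ even}}}\frac1{mn}\ln Z_{m,n}$$ exists and equals $$F(a,b,z)=\frac{2}{\pi^2}\int_0^{\pi/2}\int_0^{\pi/2}\ln\left(z^2+4a^2\cos^2\theta+4b^2\cos^2\phi\right)d\phi\,d\theta .$$
   Context: Grid graph: $Q_{m,n}$ has vertex set $\{(i,j): 1\le i\le m,\ 1\le j\le n\}$ with its standard planar embedding as points of $\mathbb{Z}^2$. Edges $\{(i,j),(i,j+1)\}$ have weight $a$, edges $\{(i,j),(i+1,j)\}$ have weight $b$, and every vertex has weight $z$. Monopole-dimer configuration on a plane graph $G=[V,E]$: a collection $C$ of pairwise vertex-disjoint directed loops of even length in $G$, where a loop of length $2$ is a doubled edge (exactly one such loop for each edge) and a loop of length $2k\ge4$ is a directed simple cycle (so each undirected cycle gives two distinct directed loops). Every vertex is either isolated (a monopole) or belongs to exactly one loop. Weights: the weight of a loop $\ell$ is $w(\ell)=(-1)^{N(\ell)}$ times the product of the weights of the edges traversed by $\ell$ (for a doubled edge, the square of the edge weight), where $N(\ell)$ is the number of vertices of $V$ strictly enclosed by $\ell$. The weight $w(C)$ is the product of $w(\ell)$ over the loops $\ell$ of $C$ and of the vertex weights over the isolated vertices of $C$. The partition function is $Z=\sum_C w(C)$, summed over all monopole-dimer configurations. *)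

theory Defs
  imports "HOL-Analysis.Analysis"
begin

text \<open>A graph drawn in the plane, which is identified with the complex numbers: \<open>place\<close> sends each
  vertex to a point, and \<open>curve\<close> sends each edge (a two-element set of vertices) to the point set
  of the arc that draws it.\<close>

record 'v plane_graph =
  verts :: "'v set"
  edges :: "'v set set"
  place :: "'v \<Rightarrow> complex"
  curve :: "'v set \<Rightarrow> complex set"

text \<open>A directed loop is encoded as its set of directed edges. Hence the starting point is
  irrelevant, an edge \<open>{u, v}\<close> gives exactly one loop \<open>{(u, v), (v, u)}\<close> of length 2, and an
  undirected cycle of length at least 4 gives two distinct loops.\<close>

definition cyclic_darts :: "'v list \<Rightarrow> ('v \<times> 'v) set" where
  "cyclic_darts vs = {(vs ! i, vs ! (Suc i mod length vs)) | i. i < length vs}"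

definition loops :: "'v plane_graph \<Rightarrow> ('v \<times> 'v) set set" where
  "loops G = {cyclic_darts vs | vs.
     set vs \<subseteq> verts G \<and> distinct vs \<and> 2 \<le> length vs \<and> even (length vs) \<and>
     (\<forall>(u, v) \<in> cyclic_darts vs. {u, v} \<in> edges G)}"

definition monopole_dimer_configs :: "'v plane_graph \<Rightarrow> ('v \<times> 'v) set set set" where
  "monopole_dimer_configs G =
     {C. C \<subseteq> loops G \<and> pairwise (\<lambda>l l'. disjnt (Field l) (Field l')) C}"

definition loop_curve :: "'v plane_graph \<Rightarrow> ('v \<times> 'v) set \<Rightarrow> complex set" where
  "loop_curve G l = (\<Union>(u, v) \<in> l. curve G {u, v})"

text \<open>A loop of length 2 is drawn as a single arc, so it encloses nothing.\<close>

definition enclosed :: "'v plane_graph \<Rightarrow> ('v \<times> 'v) set \<Rightarrow> 'v set" where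
  "enclosed G l = {v \<in> verts G. place G v \<in> inside (loop_curve G l)}"

text \<open>The product over directed edges counts the edge of a loop of length 2 twice.\<close>

definition loop_weight :: "'v plane_graph \<Rightarrow> ('v set \<Rightarrow> real) \<Rightarrow> ('v \<times> 'v) set \<Rightarrow> real" where
  "loop_weight G we l = (-1) ^ card (enclosed G l) * (\<Prod>(u, v) \<in> l. we {u, v})"

definition config_weight ::
  "'v plane_graph \<Rightarrow> ('v set \<Rightarrow> real) \<Rightarrow> ('v \<Rightarrow> real) \<Rightarrow> ('v \<times> 'v) set set \<Rightarrow> real" where
  "config_weight G we wv C =
     (\<Prod>l \<in> C. loop_weight G we l) * (\<Prod>v \<in> verts G - (\<Union>l \<in> C. Field l). wv v)"

definition monopole_dimer_partition ::
  "'v plane_graph \<Rightarrow> ('v set \<Rightarrow> real) \<Rightarrow> ('v \<Rightarrow> real) \<Rightarrow> real" where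
  "monopole_dimer_partition G we wv = (\<Sum>C \<in> monopole_dimer_configs G. config_weight G we wv C)"

lemma finite_monopole_dimer_configs:
  assumes "finite (verts G)"
  shows "finite (monopole_dimer_configs G)"
proof -
  have "cyclic_darts vs \<subseteq> verts G \<times> verts G" if "set vs \<subseteq> verts G" for vs
  proof -
    have "vs ! i \<in> verts G \<and> vs ! (Suc i mod length vs) \<in> verts G" if "i < length vs" for i
    proof -
      have "Suc i mod length vs < length vs"
        using that by (intro mod_less_divisor) auto
      then show ?thesis
        using that \<open>set vs \<subseteq> verts G\<close> nth_mem by blast
    qed
    then show ?thesis
      unfolding cyclic_darts_def by auto
  qed
  then have "loops G \<subseteq> Pow (verts G \<times> verts G)"
    unfolding loops_def by blast
  then have "monopole_dimer_configs G \<subseteq> Pow (Pow (verts G \<times> verts G))"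
    unfolding monopole_dimer_configs_def by blast
  then show ?thesis
    using assms finite_subset by blast
qed

definition grid_graph :: "nat \<Rightarrow> nat \<Rightarrow> (nat \<times> nat) plane_graph" where
  "grid_graph m n =
     \<lparr> verts = {1..m} \<times> {1..n},
       edges = {{(i, j), (i, j + 1)} | i j. 1 \<le> i \<and> i \<le> m \<and> 1 \<le> j \<and> j + 1 \<le> n} \<union>
               {{(i, j), (i + 1, j)} | i j. 1 \<le> i \<and> i + 1 \<le> m \<and> 1 \<le> j \<and> j \<le> n},
       place = (\<lambda>(i, j). Complex (real i) (real j)),
       curve = (\<lambda>e. convex hull ((\<lambda>(i, j). Complex (real i) (real j)) ` e)) \<rparr>"

definition grid_edge_weight :: "real \<Rightarrow> real \<Rightarrow> (nat \<times> nat) set \<Rightarrow> real" where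
  "grid_edge_weight a b e = (if \<exists>i j. e = {(i, j), (i, j + 1)} then a else b)"

definition grid_partition :: "real \<Rightarrow> real \<Rightarrow> real \<Rightarrow> nat \<Rightarrow> nat \<Rightarrow> real" where
  "grid_partition a b z m n =
     monopole_dimer_partition (grid_graph m n) (grid_edge_weight a b) (\<lambda>_. z)"

text \<open>Both sizes tend to infinity independently, through even values.\<close>

definition even_sizes_at_top :: "(nat \<times> nat) filter" where
  "even_sizes_at_top = inf (at_top \<times>\<^sub>F at_top) (principal {(m, n). even m \<and> even n})"

end

(*
  Let K be the matrix with diagonal entries z whose off-diagonal entries are the edge weights of the
  grid, signed by a Kasteleyn orientation.  The terms of det K that do not vanish are the
  permutations moving every vertex to itself or to a neighbour, that is, the monopole-dimer
  configurations; the cycles are even, so Z = det K once the signs of K along a directed cycle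
  multiply to -(-1)^N with N the number of enclosed vertices.  This is Pick's theorem modulo 2.  It
  follows by flattening the cycle at its lowest leftmost corner, with "enclosed" read as an odd
  number of crossings with a vertical ray; the Jordan curve theorem identifies this with the
  topological interior.

  Products of sines, twisted by signs, diagonalise K times its transpose, so that
  Z^2 is the product over p, q of z^2 + 4 a^2 cos^2(q pi/(n+1)) + 4 b^2 cos^2(p pi/(m+1)).
  Hence Z does not vanish for z > 0, and scaling a, b down to 0 shows Z > 0.  The logarithm of the
  product is a Riemann sum.
*)

theory Submission
  imports Defs "HOL-Combinatorics.Cycles" "Jordan_Normal_Form.Determinant"
begin

section \<open>Crossing numbers of lattice cycles\<close>

text \<open>The obstacle is the factor \<open>(-1) ^ N\<close>: the topological inside comes with no
  formula. Since only the parity of N matters, everything discrete is phrased with natural-number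
  counts modulo 2, taken along vertical rays at half-integer abscissas, which touch neither a
  lattice point nor a vertical edge. The topology then enters once: crossing parity is locally
  constant off the polygon, inside and outside are connected, and the centre of the unit square at
  one corner serves as test point. The matrix K is multiplied by its transpose because products of
  twisted sines are not eigenvectors of K. The transpose multiplies such a product by a factor that
  alternates with the position, and only the second application, by K, cancels the alternating
  terms. The price is that the sign of det K is lost and must be recovered separately. The angles
  are multiples of pi/(m+1) and pi/(n+1) because the sines have to vanish on the layer of points
  just outside the grid.\<close>

fun walk_sum :: "('v \<Rightarrow> 'v \<Rightarrow> nat) \<Rightarrow> 'v list \<Rightarrow> nat" where
  "walk_sum f (x # y # zs) = f x y + walk_sum f (y # zs)"
| "walk_sum f _ = 0"

definition cycle_sum :: "('v \<Rightarrow> 'v \<Rightarrow> nat) \<Rightarrow> 'v list \<Rightarrow> nat" where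
  "cycle_sum f vs = walk_sum f (vs @ [hd vs])"

lemma walk_sum_append:
  "walk_sum f (xs @ y # ys) = walk_sum f (xs @ [y]) + walk_sum f (y # ys)"
proof (induction xs)
  case (Cons x xs)
  then show ?case by (cases xs) auto
qed simp

lemma walk_sum_snoc:
  "xs \<noteq> [] \<Longrightarrow> walk_sum f (xs @ [y]) = walk_sum f xs + f (last xs) y"
  by (induction xs rule: induct_list012) auto

lemma cycle_sum_Cons:
  assumes "xs \<noteq> []"
  shows "cycle_sum f (v # xs) = f v (hd xs) + walk_sum f xs + f (last xs) v"
proof -
  obtain x xs' where "xs = x # xs'" using assms by (cases xs) auto
  then show ?thesis using walk_sum_snoc[of xs f v] by (simp add: cycle_sum_def)
qed

lemma cycle_sum_rotate: "cycle_sum f (xs @ ys) = cycle_sum f (ys @ xs)"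
proof (cases "xs = [] \<or> ys = []")
  case False
  then obtain x xs' y ys' where "xs = x # xs'" "ys = y # ys'" by (meson list.exhaust)
  then show ?thesis
    using walk_sum_append[of f xs y "ys' @ [x]"] walk_sum_append[of f ys x "xs' @ [y]"]
    by (simp add: cycle_sum_def)
qed auto

lemma walk_sum_cong:
  "successively (\<lambda>u w. f u w = g u w) xs \<Longrightarrow> walk_sum f xs = walk_sum g xs"
  by (induction xs rule: induct_list012) auto

text \<open>Modulo 2 the sum telescopes, as every inner vertex contributes \<open>g\<close> twice.
  On a closed walk the two ends agree and the sum of \<open>f\<close> is even. This yields both the
  invariance of crossing parity under a change of column and the bipartiteness of the grid.\<close>

lemma walk_sum_coboundary:
  assumes "successively (\<lambda>u w. even (f u w + g u + g w)) xs" "xs \<noteq> []"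
  shows "even (walk_sum f xs + g (hd xs) + g (last xs))"
  using assms by (induction xs rule: induct_list012) auto

lemma walk_sum_add: "walk_sum f xs + walk_sum g xs = walk_sum (\<lambda>u w. f u w + g u w) xs"
  by (induction xs rule: induct_list012) auto

fun steps :: "'v list \<Rightarrow> ('v \<times> 'v) set" where
  "steps (x # y # zs) = insert (x, y) (steps (y # zs))"
| "steps _ = {}"

lemma steps_subset: "(u, w) \<in> steps xs \<Longrightarrow> u \<in> set xs \<and> w \<in> set xs"
  by (induction xs rule: induct_list012) auto

lemma successively_iff_steps: "successively P xs \<longleftrightarrow> (\<forall>(u, w) \<in> steps xs. P u w)"
  by (induction xs rule: induct_list012) auto

lemma successively_weaken:
  assumes "successively P xs" "\<And>u w. (u, w) \<in> steps xs \<Longrightarrow> u \<in> set xs \<Longrightarrow> w \<in> set xs \<Longrightarrow> P u w \<Longrightarrow> Q u w"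
  shows "successively Q xs"
  using assms steps_subset[of _ _ xs] unfolding successively_iff_steps by fast

lemma successively_split:
  "successively P (xs @ y # ys) \<longleftrightarrow> successively P (xs @ [y]) \<and> successively P (y # ys)"
  by (auto simp: successively_append_iff)

section \<open>Lattice cycles, Kasteleyn signs and ray crossings\<close>

definition adj :: "nat \<times> nat \<Rightarrow> nat \<times> nat \<Rightarrow> bool" where
  "adj u w \<longleftrightarrow> fst u = fst w \<and> (snd w = Suc (snd u) \<or> snd u = Suc (snd w)) \<or>
               snd u = snd w \<and> (fst w = Suc (fst u) \<or> fst u = Suc (fst w))"

lemma adj_sym: "adj u w \<longleftrightarrow> adj w u"
  by (auto simp: adj_def)

definition grid_cycle :: "(nat \<times> nat) list \<Rightarrow> bool" where
  "grid_cycle vs \<longleftrightarrow> distinct vs \<and> 2 \<le> length vs \<and> successively adj (vs @ [hd vs])"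

text \<open>The Kasteleyn signs \<open>(-1) ^ orient u w\<close> multiply to \<open>-1\<close> around every unit square.\<close>

definition orient :: "nat \<times> nat \<Rightarrow> nat \<times> nat \<Rightarrow> nat" where
  "orient u w =
     (if snd u = snd w then (if fst u < fst w then 0 else 1)
      else (if snd u < snd w then fst u else Suc (fst u)))"

text \<open>Indicates that the edge \<open>uw\<close> meets the vertical ray going down from the point
  \<open>(X + 1/2, t)\<close>.\<close>

definition crosses :: "int \<Rightarrow> real \<Rightarrow> nat \<times> nat \<Rightarrow> nat \<times> nat \<Rightarrow> nat" where
  "crosses X t u w =
     of_bool (snd u = snd w \<and> (int (fst u) \<le> X) \<noteq> (int (fst w) \<le> X) \<and> real (snd u) < t)"

lemma grid_cycle_Cons:
  assumes "xs \<noteq> []"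
  shows "grid_cycle (v # xs) \<longleftrightarrow>
    distinct (v # xs) \<and> adj v (hd xs) \<and> successively adj xs \<and> adj (last xs) v"
  using assms
  by (auto simp: grid_cycle_def successively_append_iff Suc_le_eq successively_Cons)

lemma grid_cycle_rotate: "grid_cycle (xs @ ys) \<longleftrightarrow> grid_cycle (ys @ xs)"
proof (cases "xs = [] \<or> ys = []")
  case False
  then obtain x xs' y ys' where "xs = x # xs'" "ys = y # ys'" by (meson list.exhaust)
  then show ?thesis
    using successively_split[of adj xs y "ys' @ [x]"] successively_split[of adj ys x "xs' @ [y]"]
    by (auto simp: grid_cycle_def)
qed auto

text \<open>The two counts differ modulo 2 by the coboundary of the indicator \<open>?g\<close> of
  the vertices in column \<open>X + 1\<close> below height \<open>t\<close>. Horizontal edges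
  satisfy this automatically; the second assumption says that no vertical edge of that column
  straddles height \<open>t\<close>.\<close>

lemma crossings_next_column:
  assumes "successively adj (vs @ [hd vs])"
    and "\<And>u w. (u, w) \<in> steps (vs @ [hd vs]) \<Longrightarrow> adj u w \<Longrightarrow> u \<in> set vs \<Longrightarrow> w \<in> set vs \<Longrightarrow> fst u = fst w \<Longrightarrow> int (fst u) = X + 1 \<Longrightarrow>
      real (snd u) < t \<longleftrightarrow> real (snd w) < t"
    and "vs \<noteq> []"
  shows "even (cycle_sum (crosses X t) vs) \<longleftrightarrow> even (cycle_sum (crosses (X + 1) t) vs)"
proof -
  let ?g = "\<lambda>u :: nat \<times> nat. of_bool (int (fst u) = X + 1 \<and> real (snd u) < t) :: nat"
  have "successively (\<lambda>u w. even (crosses X t u w + crosses (X + 1) t u w + ?g u + ?g w)) (vs @ [hd vs])"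
  proof (rule successively_weaken[OF assms(1)])
    fix u w assume uw: "u \<in> set (vs @ [hd vs])" "w \<in> set (vs @ [hd vs])" "adj u w"
      and st: "(u, w) \<in> steps (vs @ [hd vs])"
    then have *: "u \<in> set vs" "w \<in> set vs" using assms(3) by auto
    show "even (crosses X t u w + crosses (X + 1) t u w + ?g u + ?g w)"
    proof (cases "fst u = fst w")
      case True
      then show ?thesis
        using assms(2)[OF st uw(3) *] uw(3) by (auto simp: crosses_def adj_def of_bool_def)
    next
      case False
      then have "snd u = snd w" "fst w = Suc (fst u) \<or> fst u = Suc (fst w)"
        using uw(3) by (auto simp: adj_def)
      then show ?thesis
        by (auto simp: crosses_def of_bool_def)
    qed
  qed
  from walk_sum_coboundary[OF this]
  have "even (walk_sum (\<lambda>u w. crosses X t u w + crosses (X + 1) t u w) (vs @ [hd vs]) +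
    ?g (hd (vs @ [hd vs])) + ?g (last (vs @ [hd vs])))"
    by blast
  then show ?thesis
    using assms(3) by (simp add: cycle_sum_def flip: walk_sum_add) argo
qed

text \<open>An edge passing from one side of the line at \<open>X + 1/2\<close> to the other has an
  endpoint in column \<open>X\<close>, and that endpoint is not below \<open>t\<close>.\<close>

lemma walk_crossings_eq_0:
  assumes "successively adj xs" "\<And>u. u \<in> set xs \<Longrightarrow> int (fst u) = X \<Longrightarrow> t \<le> real (snd u)"
  shows "walk_sum (crosses X t) xs = 0"
proof -
  have "successively (\<lambda>u w. crosses X t u w = 0) xs"
  proof (rule successively_weaken[OF assms(1)])
    fix u w assume uw: "u \<in> set xs" "w \<in> set xs" "adj u w"
    show "crosses X t u w = 0"
    proof (rule ccontr)
      assume "crosses X t u w \<noteq> 0"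
      then have *: "snd u = snd w" "(int (fst u) \<le> X) \<noteq> (int (fst w) \<le> X)" "real (snd u) < t"
        by (auto simp: crosses_def)
      then have "int (fst u) = X \<or> int (fst w) = X"
        using uw(3) unfolding adj_def by presburger
      then show False
        using assms(2)[OF uw(1)] assms(2)[OF uw(2)] *(1,3) by auto
    qed
  qed
  then show ?thesis
    by (induction xs rule: induct_list012) auto
qed

text \<open>The ray starts half a unit to the right of \<open>p\<close>. If \<open>p\<close> is off
  the cycle, no edge of the cycle separates \<open>p\<close> from this starting point, so the parity
  decides whether \<open>p\<close> is enclosed.\<close>

abbreviation crossings :: "nat \<times> nat \<Rightarrow> (nat \<times> nat) list \<Rightarrow> nat" where
  "crossings p \<equiv> cycle_sum (crosses (int (fst p)) (real (snd p)))"

text \<open>For a step to the right, the only obstruction is a vertical edge ending at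
  \<open>p'\<close>. For a step up, the counts could differ only by a horizontal edge ending at
  \<open>p\<close>. Both points are off the cycle.\<close>

lemma crossings_adjacent_aux:
  assumes "grid_cycle vs" "p \<notin> set vs" "p' \<notin> set vs" "p' = (Suc (fst p), snd p) \<or> p' = (fst p, Suc (snd p))"
  shows "even (crossings p vs) \<longleftrightarrow> even (crossings p' vs)"
proof -
  have vs: "successively adj (vs @ [hd vs])" "vs \<noteq> []"
    using assms(1) by (auto simp: grid_cycle_def)
  consider "p' = (Suc (fst p), snd p)" | "p' = (fst p, Suc (snd p))" using assms(4) by blast
  then show ?thesis
  proof cases
    case 1
    have "even (cycle_sum (crosses (int (fst p)) (real (snd p))) vs) \<longleftrightarrow>
      even (cycle_sum (crosses (int (fst p) + 1) (real (snd p))) vs)"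
    proof (rule crossings_next_column[OF vs(1) _ vs(2)])
      fix u w assume uw: "adj u w" "u \<in> set vs" "w \<in> set vs" "fst u = fst w"
        "int (fst u) = int (fst p) + 1"
      then have "u \<noteq> p'" "w \<noteq> p'" using assms by auto
      moreover have "fst u = Suc (fst p)" "fst w = Suc (fst p)" using uw by linarith+
      ultimately have "snd u \<noteq> snd p" "snd w \<noteq> snd p" using 1 by (metis prod.collapse)+
      moreover have "snd w = Suc (snd u) \<or> snd u = Suc (snd w)" using uw by (simp add: adj_def)
      ultimately show "real (snd u) < real (snd p) \<longleftrightarrow> real (snd w) < real (snd p)"
        unfolding of_nat_less_iff by presburger
    qed
    then show ?thesis using 1 by (simp add: add.commute)
  next
    case 2
    have "successively (\<lambda>u w. crosses (int (fst p)) (real (snd p)) u w =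
        crosses (int (fst p')) (real (snd p')) u w) (vs @ [hd vs])"
    proof (rule successively_weaken[OF vs(1)])
      fix u w assume uw: "u \<in> set (vs @ [hd vs])" "w \<in> set (vs @ [hd vs])" "adj u w"
      then have "u \<noteq> p" "w \<noteq> p" using assms vs(2) by auto
      then have "fst u \<noteq> fst p \<or> snd u \<noteq> snd p" "fst w \<noteq> fst p \<or> snd w \<noteq> snd p"
        by (auto simp: prod_eq_iff)
      then have "snd u \<noteq> snd p"
        if "snd u = snd w" "(int (fst u) \<le> int (fst p)) \<noteq> (int (fst w) \<le> int (fst p))"
        using that uw(3) unfolding adj_def of_nat_le_iff by presburger
      then show "crosses (int (fst p)) (real (snd p)) u w =
        crosses (int (fst p')) (real (snd p')) u w"
        using 2 by (auto simp: crosses_def less_Suc_eq simp del: of_nat_Suc of_nat_le_iff)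
    qed
    from walk_sum_cong[OF this] show ?thesis by (simp add: cycle_sum_def)
  qed
qed

lemma crossings_adjacent:
  assumes "grid_cycle vs" "p \<notin> set vs" "p' \<notin> set vs" "adj p p'"
  shows "even (crossings p vs) \<longleftrightarrow> even (crossings p' vs)"
proof -
  have "p' = (Suc (fst p), snd p) \<or> p' = (fst p, Suc (snd p)) \<or>
    p = (Suc (fst p'), snd p') \<or> p = (fst p', Suc (snd p'))"
    using assms(4) by (auto simp: adj_def prod_eq_iff)
  then show ?thesis
    using crossings_adjacent_aux[OF assms(1-3)] crossings_adjacent_aux[OF assms(1,3,2)] by blast
qed

lemma crossings_walk:
  assumes "grid_cycle vs" "successively adj zs" "set zs \<inter> set vs = {}" "p \<in> set zs" "q \<in> set zs"
  shows "even (crossings p vs) \<longleftrightarrow> even (crossings q vs)"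
proof -
  have "\<forall>p \<in> set zs. even (crossings p vs) \<longleftrightarrow> even (crossings (hd zs) vs)"
    using assms(2,3)
  proof (induction zs rule: induct_list012)
    case (3 x y zs)
    then show ?case using crossings_adjacent[OF assms(1), of x y] by auto
  qed auto
  then show ?thesis using assms(4,5) by blast
qed

text \<open>The corner \<open>v\<close> is the lexicographically least vertex. The pieces
  \<open>us\<close> and \<open>ws\<close> are returned so that cycle sums can be carried back to
  \<open>vs\<close> by \<open>cycle_sum_rotate\<close>.\<close>

lemma grid_cycle_corner:
  assumes "grid_cycle vs"
  obtains v xs us ws where "vs = us @ ws" "v # xs = ws @ us" "grid_cycle (v # xs)" "xs \<noteq> []"
    "\<forall>u \<in> set xs. fst v < fst u \<or> fst v = fst u \<and> snd v < snd u"
proof -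
  define x where "x = Min (fst ` set vs)"
  define y where "y = Min (snd ` {u \<in> set vs. fst u = x})"
  have "set vs \<noteq> {}" using assms by (auto simp: grid_cycle_def)
  then have "x \<in> fst ` set vs" unfolding x_def by (intro Min_in) auto
  then have "y \<in> snd ` {u \<in> set vs. fst u = x}" unfolding y_def by (intro Min_in) auto
  then have v: "(x, y) \<in> set vs" by auto
  have le: "x < fst u \<or> x = fst u \<and> y \<le> snd u" if "u \<in> set vs" for u
  proof -
    have "x \<le> fst u" unfolding x_def using that by auto
    moreover have "y \<le> snd u" if "x = fst u"
      unfolding y_def using \<open>u \<in> set vs\<close> that by (intro Min_le) auto
    ultimately show ?thesis by linarith
  qed
  obtain us ws where vs: "vs = us @ (x, y) # ws" using split_list[OF v] by blast
  have "grid_cycle (((x, y) # ws) @ us)" using assms vs grid_cycle_rotate by blast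
  then have g: "grid_cycle ((x, y) # (ws @ us))" by simp
  then have "ws @ us \<noteq> []" by (auto simp: grid_cycle_def)
  moreover have "x < fst u \<or> x = fst u \<and> y < snd u" if "u \<in> set (ws @ us)" for u
  proof -
    have "u \<noteq> (x, y)" using that g by (auto simp: grid_cycle_def)
    moreover have "u \<in> set vs" using that vs by auto
    ultimately show ?thesis using le[of u] by (auto simp: prod_eq_iff)
  qed
  ultimately show ?thesis using that[of us "(x, y) # ws" "(x, y)" "ws @ us"] vs g by auto
qed

text \<open>The left and lower neighbours of \<open>v\<close> are lexicographically smaller, so only
  two candidates remain; with at least three vertices on the cycle, its two edges at
  \<open>v\<close> use both.\<close>

lemma corner_neighbours:
  assumes "grid_cycle (v # xs)" "2 \<le> length xs"
    "\<forall>u \<in> set xs. fst v < fst u \<or> fst v = fst u \<and> snd v < snd u"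
  shows "hd xs = (Suc (fst v), snd v) \<and> last xs = (fst v, Suc (snd v)) \<or>
    hd xs = (fst v, Suc (snd v)) \<and> last xs = (Suc (fst v), snd v)"
proof -
  have ne: "xs \<noteq> []" using assms(2) by auto
  then have c: "distinct xs" "adj v (hd xs)" "adj (last xs) v"
    using assms(1) by (auto simp: grid_cycle_Cons)
  have "hd xs \<noteq> last xs" using c(1) assms(2) ne
    by (cases xs) auto
  moreover have "u = (Suc (fst v), snd v) \<or> u = (fst v, Suc (snd v))" if "u \<in> set xs" "adj v u" for u
    using bspec[OF assms(3) that(1)] that(2) by (auto simp: adj_def prod_eq_iff)
  ultimately show ?thesis using c adj_sym ne by (metis hd_in_set last_in_set)
qed

text \<open>All other vertices of the cycle in column \<open>fst v\<close> have height at least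
  \<open>snd v + 1\<close>, so the ray meets nothing but the horizontal edge at
  \<open>v\<close>.\<close>

lemma corner_crossings:
  assumes "grid_cycle (v # xs)" "2 \<le> length xs"
    "\<forall>u \<in> set xs. fst v < fst u \<or> fst v = fst u \<and> snd v < snd u"
    and "real (snd v) < t" "t \<le> real (snd v) + 1"
  shows "cycle_sum (crosses (int (fst v)) t) (v # xs) = 1"
proof -
  have ne: "xs \<noteq> []" using assms(2) by auto
  have "walk_sum (crosses (int (fst v)) t) xs = 0"
  proof (rule walk_crossings_eq_0)
    show "successively adj xs" using assms(1) ne by (simp add: grid_cycle_Cons)
    show "t \<le> real (snd u)" if "u \<in> set xs" "int (fst u) = int (fst v)" for u
      using bspec[OF assms(3) that(1)] that(2) assms(5) by auto
  qed
  moreover have "crosses (int (fst v)) t v (hd xs) + crosses (int (fst v)) t (last xs) v = 1"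
    using corner_neighbours[OF assms(1-3)] assms(4)
    by (elim disjE conjE) (simp_all add: crosses_def)
  ultimately show ?thesis
    by (simp add: cycle_sum_Cons[OF ne])
qed

text \<open>The four darts form two routes from \<open>q\<close> to \<open>p\<close> around the
  square. Reversing one route gives the boundary cycle and changes two signs, so this is the
  Kasteleyn condition for the square.\<close>

lemma odd_orient_square:
  assumes "p = (Suc x, y) \<and> q = (x, Suc y) \<or> p = (x, Suc y) \<and> q = (Suc x, y)"
  shows "odd (orient (x, y) p + orient q (x, y) + orient (Suc x, Suc y) p + orient q (Suc x, Suc y))"
  using assms by (elim disjE conjE) (simp_all add: orient_def)

text \<open>Only the two horizontal sides can be crossed, and in the column of the square the ray
  meets both or neither unless it starts between their heights, which the second assumption
  excludes.\<close>

lemma even_crosses_square: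
  assumes "p = (Suc x, y) \<and> q = (x, Suc y) \<or> p = (x, Suc y) \<and> q = (Suc x, y)"
    and "X \<noteq> int x \<or> real y < t \<longleftrightarrow> X \<noteq> int x \<or> real y + 1 < t"
  shows "even (crosses X t (x, y) p + crosses X t q (x, y) +
    crosses X t (Suc x, Suc y) p + crosses X t q (Suc x, Suc y))"
proof -
  have "(int x \<le> X) \<noteq> (int (Suc x) \<le> X) \<longleftrightarrow> X = int x" by linarith
  then show ?thesis
    using assms by (elim disjE conjE) (auto simp add: crosses_def add.commute simp del: of_nat_Suc)
qed

text \<open>The upper left corner is the one lattice point whose ray starts in the column of the
  square and separates its sides: the comparison of heights in \<open>crosses\<close> is strict, so
  that ray meets the lower side and not the upper one.\<close>

lemma even_crossings_square:
  assumes "p = (Suc x, y) \<and> q = (x, Suc y) \<or> p = (x, Suc y) \<and> q = (Suc x, y)"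
    and "r \<noteq> (x, Suc y)"
  defines "c \<equiv> crosses (int (fst r)) (real (snd r))"
  shows "even (c (x, y) p + c q (x, y) + c (Suc x, Suc y) p + c q (Suc x, Suc y))"
  unfolding c_def
proof (rule even_crosses_square[OF assms(1)])
  have "fst r \<noteq> x \<or> snd r \<noteq> Suc y" using assms(2) by (auto simp: prod_eq_iff)
  then show "int (fst r) \<noteq> int x \<or> real y < real (snd r) \<longleftrightarrow>
    int (fst r) \<noteq> int x \<or> real y + 1 < real (snd r)" by linarith
qed

section \<open>Pick's theorem modulo 2\<close>

lemma even_sum_iff:
  "finite A \<Longrightarrow> (\<And>x. x \<in> A \<Longrightarrow> even (f x) \<longleftrightarrow> even (g x)) \<Longrightarrow>
    even (\<Sum>x\<in>A. f x :: nat) \<longleftrightarrow> even (\<Sum>x\<in>A. g x :: nat)"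
  by (induction A rule: finite_induct) auto

lemma even_sumI: "(\<And>x. x \<in> A \<Longrightarrow> even (f x)) \<Longrightarrow> even (\<Sum>x\<in>A. f x :: nat)"
  by (simp add: dvd_sum)

text \<open>Modulo 2 this is the number of points of \<open>G\<close> enclosed by the cycle: a point
  off the cycle adds an odd number exactly if ray parity puts it inside.\<close>

definition exterior_crossings :: "(nat \<times> nat) set \<Rightarrow> (nat \<times> nat) list \<Rightarrow> nat" where
  "exterior_crossings G vs = (\<Sum>r \<in> G - set vs. crossings r vs)"

text \<open>Pushing the corner \<open>v\<close> across its unit square to \<open>d\<close> changes
  both parities. The sum of \<open>orient\<close> changes by the Kasteleyn condition. Among the
  enclosed points exactly \<open>d\<close> is lost: it moves onto the cycle, while \<open>v\<close>
  becomes an outside point and all other points keep their status.\<close>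

lemma pick_flip:
  assumes "finite G" "grid_cycle (v # xs)" "2 \<le> length xs"
    and low: "\<forall>u \<in> set xs. fst v < fst u \<or> fst v = fst u \<and> snd v < snd u"
    and d: "d = (Suc (fst v), Suc (snd v))" "d \<notin> set xs" "d \<in> G" "v \<in> G"
  shows "grid_cycle (d # xs)"
    and "odd (cycle_sum orient (d # xs) + exterior_crossings G (d # xs)) \<longleftrightarrow>
      odd (cycle_sum orient (v # xs) + exterior_crossings G (v # xs))"
proof -
  have ne: "xs \<noteq> []" using assms(3) by auto
  define p q where "p = hd xs" and "q = last xs"
  have pq: "p = (Suc (fst v), snd v) \<and> q = (fst v, Suc (snd v)) \<or>
    p = (fst v, Suc (snd v)) \<and> q = (Suc (fst v), snd v)"
    using corner_neighbours[OF assms(2,3) low] by (simp add: p_def q_def)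
  have c: "distinct (v # xs)" "successively adj xs"
    using assms(2) ne by (auto simp: grid_cycle_Cons)
  have adj: "adj d p" "adj q d"
    using pq d by (auto simp: adj_def)
  then show cyc: "grid_cycle (d # xs)"
    using c d(2) ne by (simp add: grid_cycle_Cons p_def q_def)
  have vd: "v \<noteq> d" using d by (auto simp: prod_eq_iff)
  have sums: "cycle_sum f (v # xs) + cycle_sum f (d # xs) =
    2 * walk_sum f xs + (f v p + f q v + f d p + f q d)" for f
    using cycle_sum_Cons[OF ne, of f] by (simp add: p_def q_def)
  define R where "R = G - insert v (insert d (set xs))"
  have fin: "finite R" using assms(1) by (simp add: R_def)
  have "G - set (v # xs) = insert d R" "G - set (d # xs) = insert v R" "v \<notin> R" "d \<notin> R"
    using d vd c(1) by (auto simp: R_def)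
  then have ext: "exterior_crossings G (v # xs) = crossings d (v # xs) + (\<Sum>r\<in>R. crossings r (v # xs))"
    "exterior_crossings G (d # xs) = crossings v (d # xs) + (\<Sum>r\<in>R. crossings r (d # xs))"
    using fin by (simp_all add: exterior_crossings_def)
  have "even (crossings r (v # xs)) \<longleftrightarrow> even (crossings r (d # xs))" if "r \<in> R" for r
  proof -
    have "(fst v, Suc (snd v)) \<in> set xs" using pq ne by (metis p_def q_def hd_in_set last_in_set)
    then have "r \<noteq> (fst v, Suc (snd v))" using that by (auto simp: R_def)
    from even_crossings_square[OF pq this]
    have "even (crossings r (v # xs) + crossings r (d # xs))"
      unfolding sums by (simp add: d(1))
    then show ?thesis by simp
  qed
  then have R: "even (\<Sum>r\<in>R. crossings r (v # xs)) \<longleftrightarrow> even (\<Sum>r\<in>R. crossings r (d # xs))"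
    by (intro even_sum_iff fin)
  have "crossings v (d # xs) = 0"
    unfolding cycle_sum_def
  proof (rule walk_crossings_eq_0)
    show "successively adj ((d # xs) @ [hd (d # xs)])" using cyc by (simp add: grid_cycle_def)
    show "real (snd v) \<le> real (snd u)"
      if "u \<in> set ((d # xs) @ [hd (d # xs)])" "int (fst u) = int (fst v)" for u
      using that low d(1) by fastforce
  qed
  \<comment> \<open>The ray of \<open>d\<close> runs in column \<open>fst v + 1\<close>. As
    \<open>d\<close> is off the cycle it may be moved one column to the left, where
    \<open>corner_crossings\<close> counts exactly one crossing.\<close>
  moreover have "odd (crossings d (v # xs))"
  proof -
    have "even (cycle_sum (crosses (int (fst v)) (real (snd d))) (v # xs)) \<longleftrightarrow>
      even (cycle_sum (crosses (int (fst v) + 1) (real (snd d))) (v # xs))"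
    proof (rule crossings_next_column)
      show "successively adj ((v # xs) @ [hd (v # xs)])" using assms(2) by (simp add: grid_cycle_def)
      fix u w assume uw: "adj u w" "u \<in> set (v # xs)" "w \<in> set (v # xs)" "fst u = fst w"
        "int (fst u) = int (fst v) + 1"
      then have "u \<noteq> d" "w \<noteq> d" using vd d(2) by auto
      moreover have "fst u = fst d" "fst w = fst d" using uw d(1) by auto
      ultimately have "snd u \<noteq> snd d" "snd w \<noteq> snd d" by (metis prod_eq_iff)+
      moreover have "snd w = Suc (snd u) \<or> snd u = Suc (snd w)" using uw by (simp add: adj_def)
      ultimately show "real (snd u) < real (snd d) \<longleftrightarrow> real (snd w) < real (snd d)"
        unfolding of_nat_less_iff by presburger
    qed simp
    moreover have "cycle_sum (crosses (int (fst v)) (real (snd d))) (v # xs) = 1"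
      by (rule corner_crossings[OF assms(2,3) low]) (simp_all add: d(1))
    ultimately show ?thesis by (simp add: d(1) add.commute)
  qed
  moreover have "odd (orient v p + orient q v + orient d p + orient q d)"
    using odd_orient_square[OF pq] by (simp add: d(1))
  then have "odd (cycle_sum orient (v # xs) + cycle_sum orient (d # xs))"
    unfolding sums by simp
  ultimately show "odd (cycle_sum orient (d # xs) + exterior_crossings G (d # xs)) \<longleftrightarrow>
      odd (cycle_sum orient (v # xs) + exterior_crossings G (v # xs))"
    using R by (auto simp: ext)
qed

text \<open>If the opposite corner \<open>d\<close> already lies on the cycle, removing the unit
  square pinches the cycle at \<open>d\<close> into two shorter ones. Their enclosed points together
  are those of the original cycle modulo 2, and the square adds one to the sum of
  \<open>orient\<close>. This extra one is why odd becomes even in the last claim: two odd pieces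
  give an odd whole.\<close>

lemma pick_split:
  assumes "finite G" "grid_cycle (v # xs)" "2 \<le> length xs" "set (v # xs) \<subseteq> G"
    and low: "\<forall>u \<in> set xs. fst v < fst u \<or> fst v = fst u \<and> snd v < snd u"
    and d: "d = (Suc (fst v), Suc (snd v))" "xs = us @ d # ws"
  shows "us \<noteq> []" "ws \<noteq> []" "grid_cycle (d # us)" "grid_cycle (d # ws)"
    and "odd (cycle_sum orient (v # xs) + exterior_crossings G (v # xs)) \<longleftrightarrow>
      even (cycle_sum orient (d # us) + exterior_crossings G (d # us) +
        (cycle_sum orient (d # ws) + exterior_crossings G (d # ws)))"
proof -
  have ne: "xs \<noteq> []" using assms(3) by auto
  define p q where "p = hd xs" and "q = last xs"
  have pq: "p = (Suc (fst v), snd v) \<and> q = (fst v, Suc (snd v)) \<or>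
    p = (fst v, Suc (snd v)) \<and> q = (Suc (fst v), snd v)"
    using corner_neighbours[OF assms(2,3) low] by (simp add: p_def q_def)
  then have "p \<noteq> d" "q \<noteq> d" by (auto simp: d(1))
  then show ne': "us \<noteq> []" "ws \<noteq> []"
    by (auto simp: p_def q_def d(2))
  then have hl: "p = hd us" "q = last ws"
    by (auto simp: p_def q_def d(2))
  have c: "distinct (v # xs)" "successively adj xs" "adj v p" "adj q v"
    using assms(2) ne by (auto simp: grid_cycle_Cons p_def q_def)
  have mem: "p \<in> set us" "q \<in> set ws" using hl ne' by simp_all
  have adj: "adj d p" "adj q d"
    using pq d by (auto simp: adj_def)
  have usws: "successively adj us" "adj (last us) d" "successively adj ws" "adj d (hd ws)"
    using c(2) ne' by (auto simp: d(2) successively_append_iff successively_Cons)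
  have dist: "distinct (d # us)" "distinct (d # ws)" "set us \<inter> set ws = {}"
    "v \<notin> set us" "v \<notin> set ws" "v \<noteq> d"
    using c(1) by (auto simp: d(2))
  show cyc: "grid_cycle (d # us)" "grid_cycle (d # ws)"
    using dist adj usws by (auto simp: grid_cycle_Cons ne' simp flip: hl)
  \<comment> \<open>Together the three cycles run twice through each step of \<open>xs\<close> and
    once through each of the four darts of the square.\<close>
  have sums: "cycle_sum f (v # xs) + (cycle_sum f (d # us) + cycle_sum f (d # ws)) =
    2 * (walk_sum f us + f (last us) d + f d (hd ws) + walk_sum f ws) +
    (f v p + f q v + f d p + f q d)" for f
  proof -
    have "walk_sum f xs = walk_sum f us + f (last us) d + f d (hd ws) + walk_sum f ws"
      using ne' walk_sum_append[of f us d ws] walk_sum_snoc[of us f d]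
      by (cases ws) (auto simp: d(2))
    then show ?thesis
      using cycle_sum_Cons[OF ne, of f v] cycle_sum_Cons[OF ne'(1), of f d]
        cycle_sum_Cons[OF ne'(2), of f d] by (simp flip: hl p_def q_def)
  qed
  define R where "R = G - set (v # xs)"
  have fin: "finite R" using assms(1) by (simp add: R_def)
  have low0: "crossings v (d # ys) = 0" if "grid_cycle (d # ys)" "set ys \<subseteq> set xs" for ys
    unfolding cycle_sum_def
  proof (rule walk_crossings_eq_0)
    show "successively adj ((d # ys) @ [hd (d # ys)])" using that by (simp add: grid_cycle_def)
    show "real (snd v) \<le> real (snd u)"
      if "u \<in> set ((d # ys) @ [hd (d # ys)])" "int (fst u) = int (fst v)" for u
      using that \<open>set ys \<subseteq> set xs\<close> low d(1) by fastforce
  qed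
  have v0: "crossings v (d # us) = 0" "crossings v (d # ws) = 0"
    by (intro low0 cyc; auto simp: d(2))+
  \<comment> \<open>Points of \<open>ws\<close> are outside \<open>d # us\<close>: \<open>ws\<close>
    leads to \<open>q\<close> and then to \<open>v\<close> without touching that cycle, and the ray
    of \<open>v\<close> meets nothing. The claim \<open>us0\<close> is the mirror image.\<close>
  have ws0: "even (crossings r (d # us))" if "r \<in> set ws" for r
  proof -
    have "even (crossings q (d # us)) \<longleftrightarrow> even (crossings v (d # us))"
      using dist c(4) mem by (intro crossings_adjacent[OF cyc(1)]) auto
    moreover have "even (crossings r (d # us)) \<longleftrightarrow> even (crossings q (d # us))"
      using dist mem that by (intro crossings_walk[OF cyc(1) usws(3)]) auto
    ultimately show ?thesis using v0(1) by simp
  qed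
  have us0: "even (crossings r (d # ws))" if "r \<in> set us" for r
  proof -
    have "even (crossings v (d # ws)) \<longleftrightarrow> even (crossings p (d # ws))"
      using dist c(3) mem by (intro crossings_adjacent[OF cyc(2)]) auto
    moreover have "even (crossings r (d # ws)) \<longleftrightarrow> even (crossings p (d # ws))"
      using dist mem that by (intro crossings_walk[OF cyc(2) usws(1)]) auto
    ultimately show ?thesis using v0(2) by simp
  qed
  have "G - set (d # us) = R \<union> insert v (set ws)" "R \<inter> insert v (set ws) = {}"
    using assms(4) dist by (auto simp: R_def d(2))
  then have "exterior_crossings G (d # us) =
    (\<Sum>r\<in>R. crossings r (d # us)) + (\<Sum>r\<in>insert v (set ws). crossings r (d # us))"
    using fin by (simp only: exterior_crossings_def) (subst sum.union_disjoint; simp)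
  moreover have "even (\<Sum>r\<in>insert v (set ws). crossings r (d # us))"
    using ws0 v0(1) by (intro even_sumI) auto
  moreover have "G - set (d # ws) = R \<union> insert v (set us)" "R \<inter> insert v (set us) = {}"
    using assms(4) dist by (auto simp: R_def d(2))
  then have "exterior_crossings G (d # ws) =
    (\<Sum>r\<in>R. crossings r (d # ws)) + (\<Sum>r\<in>insert v (set us). crossings r (d # ws))"
    using fin by (simp only: exterior_crossings_def) (subst sum.union_disjoint; simp)
  moreover have "even (\<Sum>r\<in>insert v (set us). crossings r (d # ws))"
    using us0 v0(2) by (intro even_sumI) auto
  moreover have "even (\<Sum>r\<in>R. crossings r (v # xs)) \<longleftrightarrow>
    even (\<Sum>r\<in>R. crossings r (d # us) + crossings r (d # ws))"
  proof (intro even_sum_iff fin)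
    fix r assume "r \<in> R"
    have "(fst v, Suc (snd v)) \<in> set xs" using pq ne by (metis p_def q_def hd_in_set last_in_set)
    then have "r \<noteq> (fst v, Suc (snd v))" using \<open>r \<in> R\<close> by (auto simp: R_def)
    from even_crossings_square[OF pq this]
    have "even (crossings r (v # xs) + (crossings r (d # us) + crossings r (d # ws)))"
      unfolding sums by (simp add: d(1))
    then show "even (crossings r (v # xs)) \<longleftrightarrow> even (crossings r (d # us) + crossings r (d # ws))"
      by simp
  qed
  moreover have "odd (orient v p + orient q v + orient d p + orient q d)"
    using odd_orient_square[OF pq] by (simp add: d(1))
  then have "odd (cycle_sum orient (v # xs) + (cycle_sum orient (d # us) + cycle_sum orient (d # ws)))"
    unfolding sums by simp
  moreover have "exterior_crossings G (v # xs) = (\<Sum>r\<in>R. crossings r (v # xs))"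
    by (simp add: exterior_crossings_def R_def)
  ultimately show "odd (cycle_sum orient (v # xs) + exterior_crossings G (v # xs)) \<longleftrightarrow>
      even (cycle_sum orient (d # us) + exterior_crossings G (d # us) +
        (cycle_sum orient (d # ws) + exterior_crossings G (d # ws)))"
    by (auto simp: sum.distrib)
qed

text \<open>Pick's theorem modulo 2: for a cycle with \<open>I\<close> interior points, area \<open>A\<close> and length \<open>2k\<close>, the
  sum of \<open>orient\<close> is congruent to \<open>A + k\<close>, and hence to \<open>I + 1\<close>.\<close>

theorem pick_parity:
  assumes "grid_cycle vs" "set vs \<subseteq> {1..m} \<times> {1..n}"
  shows "odd (cycle_sum orient vs + exterior_crossings ({1..m} \<times> {1..n}) vs)"
  using assms
\<comment> \<open>A split shortens the cycle. A flip keeps the length but raises one coordinate sum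
  by 2; as \<open>d\<close> stays in the grid, the truncated subtraction in the second measure
  really drops.\<close>
proof (induction vs rule: wf_induct[OF wf_measures[of "[length, \<lambda>vs. \<Sum>v\<leftarrow>vs. m + n - fst v - snd v]"]])
  case (1 vs)
  let ?G = "{1..m} \<times> {1..n}"
  let ?P = "\<lambda>vs. odd (cycle_sum orient vs + exterior_crossings ?G vs)"
  let ?\<mu> = "\<lambda>vs :: (nat \<times> nat) list. \<Sum>v\<leftarrow>vs. m + n - fst v - snd v"
  have IH: "?P ys" if "length ys < length vs \<or> length ys = length vs \<and> ?\<mu> ys < ?\<mu> vs"
    "grid_cycle ys" "set ys \<subseteq> ?G" for ys
    by (rule 1(1)[rule_format, OF _ that(2,3)]) (use that(1) in \<open>simp add: measures_less\<close>)
  obtain v xs us' ws' where rot: "vs = us' @ ws'" "v # xs = ws' @ us'"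
    and cyc: "grid_cycle (v # xs)" "xs \<noteq> []"
    and low: "\<forall>u \<in> set xs. fst v < fst u \<or> fst v = fst u \<and> snd v < snd u"
    by (rule grid_cycle_corner[OF 1(2)])
  have same: "set (v # xs) = set vs" "length (v # xs) = length vs" "?\<mu> (v # xs) = ?\<mu> vs"
    unfolding rot by auto
  then have sub: "set (v # xs) \<subseteq> ?G" using 1(3) by simp
  have "?P (v # xs)"
  proof (cases "2 \<le> length xs")
    case False
    then obtain w where xs: "xs = [w]" using cyc(2) by (cases xs; cases "tl xs") auto
    have "adj v w" using cyc xs by (auto simp: grid_cycle_def)
    \<comment> \<open>Base case of a doubled edge: its two darts carry opposite signs, and a ray
      meets both of them or neither.\<close>
    then have "odd (cycle_sum orient [v, w])"
      by (auto simp: adj_def cycle_sum_def orient_def)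
    moreover have "even (exterior_crossings ?G [v, w])"
      unfolding exterior_crossings_def
      by (intro even_sumI) (auto simp: cycle_sum_def crosses_def)
    ultimately show ?thesis by (simp add: xs)
  next
    case True
    define d where "d = (Suc (fst v), Suc (snd v))"
    have nb: "(Suc (fst v), snd v) \<in> set xs" "(fst v, Suc (snd v)) \<in> set xs"
      using corner_neighbours[OF cyc(1) True low] cyc(2) by (metis hd_in_set last_in_set)+
    then have dG: "d \<in> ?G" using sub by (auto simp: d_def)
    have vG: "v \<in> ?G" using sub by auto
    show ?thesis
    proof (cases "d \<in> set xs")
      case False
      note flip = pick_flip[OF _ cyc(1) True low d_def False dG vG]
      have "?\<mu> (d # xs) < ?\<mu> (v # xs)" using dG by (auto simp: d_def)
      then have "?P (d # xs)"
        using flip(1) sub dG same by (intro IH) auto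
      then show ?thesis using flip(2) by simp
    next
      case True
      then obtain us ws where xs: "xs = us @ d # ws" by (meson split_list)
      note split = pick_split[OF _ cyc(1) \<open>2 \<le> length xs\<close> sub low d_def xs]
      have len: "length (d # us) < length vs" "length (d # ws) < length vs"
        using split(1,2) same(2) by (auto simp: xs)
      have "set (d # us) \<subseteq> ?G" "set (d # ws) \<subseteq> ?G"
        using sub dG by (auto simp: xs)
      with len split(3,4) have "?P (d # us)" "?P (d # ws)"
        using IH by blast+
      then show ?thesis using split(5) by simp
    qed
  qed
  moreover have "crossings r (v # xs) = crossings r vs" for r
    unfolding rot by (rule cycle_sum_rotate)
  moreover have "cycle_sum orient (v # xs) = cycle_sum orient vs"
    unfolding rot by (rule cycle_sum_rotate)
  ultimately show ?case
    using same(1) by (simp add: exterior_crossings_def)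
qed

section \<open>Interiors of lattice polygons\<close>

definition pt :: "nat \<times> nat \<Rightarrow> complex" where
  "pt = (\<lambda>(i, j). Complex (real i) (real j))"

lemma Re_pt [simp]: "Re (pt u) = real (fst u)" and Im_pt [simp]: "Im (pt u) = real (snd u)"
  by (auto simp: pt_def split: prod.splits)

lemma pt_eq_iff [simp]: "pt u = pt w \<longleftrightarrow> u = w"
  by (auto simp: complex_eq_iff prod_eq_iff)

lemma adj_cases:
  assumes "adj u w"
  obtains i j where "{u, w} = {(i, j), (Suc i, j)}" | i j where "{u, w} = {(i, j), (i, Suc j)}"
  using assms by (cases u; cases w) (auto simp: adj_def insert_commute)

lemma mem_segment_horizontal:
  "z \<in> closed_segment (pt (i, j)) (pt (Suc i, j)) \<longleftrightarrow> Im z = real j \<and> real i \<le> Re z \<and> Re z \<le> real i + 1"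
  by (subst closed_segment_same_Im) (auto simp: closed_segment_eq_real_ivl)

lemma mem_segment_vertical:
  "z \<in> closed_segment (pt (i, j)) (pt (i, Suc j)) \<longleftrightarrow> Re z = real i \<and> real j \<le> Im z \<and> Im z \<le> real j + 1"
  by (subst closed_segment_same_Re) (auto simp: closed_segment_eq_real_ivl)

lemma segment_cong:
  "{u, w} = {u', w'} \<Longrightarrow> closed_segment (pt u) (pt w) = closed_segment (pt u') (pt w')"
  by (auto simp: doubleton_eq_iff closed_segment_commute)

lemma mem_edge_horizontal:
  assumes "{u, w} = {(i, j), (Suc i, j)}" "z \<in> closed_segment (pt u) (pt w)"
  shows "Im z = real j" "real i \<le> Re z" "Re z \<le> real i + 1"
  using assms(2) unfolding segment_cong[OF assms(1)] mem_segment_horizontal by auto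

lemma mem_edge_vertical:
  assumes "{u, w} = {(i, j), (i, Suc j)}" "z \<in> closed_segment (pt u) (pt w)"
  shows "Re z = real i" "real j \<le> Im z" "Im z \<le> real j + 1"
  using assms(2) unfolding segment_cong[OF assms(1)] mem_segment_vertical by auto

text \<open>Parallel edges that meet are consecutive on one line, and a horizontal edge meets a
  vertical one only in a lattice point. This makes the polygon of a lattice cycle a simple
  curve.\<close>

lemma segments_Int:
  assumes "adj u w" "adj u' w'" "{u, w} \<noteq> {u', w'}"
    and "z \<in> closed_segment (pt u) (pt w)" "z \<in> closed_segment (pt u') (pt w')"
  shows "\<exists>r. r \<in> {u, w} \<and> r \<in> {u', w'} \<and> z = pt r"
  using assms(1)
proof (cases rule: adj_cases)
  case (1 i j)
  note z = mem_edge_horizontal[OF 1 assms(4)]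
  show ?thesis using assms(2)
  proof (cases rule: adj_cases)
    case h: (1 k l)
    note z' = mem_edge_horizontal[OF h assms(5)]
    have "l = j" "k \<le> Suc i" "i \<le> Suc k" using z z' by linarith+
    moreover have "k \<noteq> i" using assms(3) h 1 \<open>l = j\<close> by auto
    ultimately have "k = Suc i \<or> i = Suc k" by linarith
    then show ?thesis
    proof
      assume "k = Suc i"
      then have "z = pt (k, j)" using z z' by (simp add: complex_eq_iff)
      then show ?thesis unfolding 1 h using \<open>l = j\<close> \<open>k = Suc i\<close> by blast
    next
      assume "i = Suc k"
      then have "z = pt (i, j)" using z z' by (simp add: complex_eq_iff)
      then show ?thesis unfolding 1 h using \<open>l = j\<close> \<open>i = Suc k\<close> by blast
    qed
  next
    case v: (2 k l)
    note z' = mem_edge_vertical[OF v assms(5)]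
    have "z = pt (k, j)" using z z' by (simp add: complex_eq_iff)
    moreover have "k = i \<or> k = Suc i" "j = l \<or> j = Suc l" using z z' by linarith+
    ultimately show ?thesis unfolding 1 v by blast
  qed
next
  case (2 i j)
  note z = mem_edge_vertical[OF 2 assms(4)]
  show ?thesis using assms(2)
  proof (cases rule: adj_cases)
    case h: (1 k l)
    note z' = mem_edge_horizontal[OF h assms(5)]
    have "z = pt (i, l)" using z z' by (simp add: complex_eq_iff)
    moreover have "i = k \<or> i = Suc k" "l = j \<or> l = Suc j" using z z' by linarith+
    ultimately show ?thesis unfolding 2 h by blast
  next
    case v: (2 k l)
    note z' = mem_edge_vertical[OF v assms(5)]
    have "k = i" "l \<le> Suc j" "j \<le> Suc l" using z z' by linarith+
    moreover have "l \<noteq> j" using assms(3) v 2 \<open>k = i\<close> by auto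
    ultimately have "l = Suc j \<or> j = Suc l" by linarith
    then show ?thesis
    proof
      assume "l = Suc j"
      then have "z = pt (i, l)" using z z' by (simp add: complex_eq_iff)
      then show ?thesis unfolding 2 v using \<open>k = i\<close> \<open>l = Suc j\<close> by blast
    next
      assume "j = Suc l"
      then have "z = pt (i, j)" using z z' by (simp add: complex_eq_iff)
      then show ?thesis unfolding 2 v using \<open>k = i\<close> \<open>j = Suc l\<close> by blast
    qed
  qed
qed

lemma pt_mem_segment:
  assumes "adj u w" "pt r \<in> closed_segment (pt u) (pt w)"
  shows "r = u \<or> r = w"
  using assms(1)
proof (cases rule: adj_cases)
  case (1 i j)
  then have "snd r = j" "i \<le> fst r" "fst r \<le> Suc i"
    using mem_edge_horizontal[OF 1 assms(2)] by auto
  then have "r \<in> {(i, j), (Suc i, j)}" by (cases r) auto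
  then show ?thesis using 1 by blast
next
  case (2 i j)
  then have "fst r = i" "j \<le> snd r" "snd r \<le> Suc j"
    using mem_edge_vertical[OF 2 assms(2)] by auto
  then have "r \<in> {(i, j), (i, Suc j)}" by (cases r) auto
  then show ?thesis using 2 by blast
qed

definition polyline :: "(nat \<times> nat) list \<Rightarrow> complex set" where
  "polyline xs = (\<Union>(u, w) \<in> steps xs. closed_segment (pt u) (pt w))"

abbreviation polygon :: "(nat \<times> nat) list \<Rightarrow> complex set" where
  "polygon vs \<equiv> polyline (vs @ [hd vs])"

text \<open>A parametrisation of \<open>polyline\<close>, since the Jordan curve theorem speaks of
  paths and not of point sets. Joining from the right follows the recursion of
  \<open>steps\<close>.\<close>

fun poly_path :: "(nat \<times> nat) list \<Rightarrow> real \<Rightarrow> complex" where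
  "poly_path (x # y # z # zs) = linepath (pt x) (pt y) +++ poly_path (y # z # zs)"
| "poly_path [x, y] = linepath (pt x) (pt y)"
| "poly_path _ = undefined"

lemma poly_path:
  assumes "distinct xs" "2 \<le> length xs" "successively adj xs"
  shows "arc (poly_path xs) \<and> pathstart (poly_path xs) = pt (hd xs) \<and>
    pathfinish (poly_path xs) = pt (last xs) \<and> path_image (poly_path xs) = polyline xs"
  using assms
proof (induction xs rule: poly_path.induct)
  case (1 x y z zs)
  then have IH: "arc (poly_path (y # z # zs))" "pathstart (poly_path (y # z # zs)) = pt y"
    "pathfinish (poly_path (y # z # zs)) = pt (last (z # zs))"
    "path_image (poly_path (y # z # zs)) = polyline (y # z # zs)"
    by auto
  have "closed_segment (pt x) (pt y) \<inter> polyline (y # z # zs) \<subseteq> {pt y}"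
  proof
    fix c assume "c \<in> closed_segment (pt x) (pt y) \<inter> polyline (y # z # zs)"
    then obtain u w where c: "(u, w) \<in> steps (y # z # zs)" "c \<in> closed_segment (pt x) (pt y)"
      "c \<in> closed_segment (pt u) (pt w)"
      unfolding polyline_def by blast
    then have x: "x \<noteq> u" "x \<noteq> w" using 1(2) steps_subset[OF c(1)] by auto
    moreover have "adj u w" "adj x y"
      using 1(4) c(1) unfolding successively_iff_steps by auto
    ultimately obtain r where "r \<in> {x, y}" "r \<in> {u, w}" "c = pt r"
      using segments_Int[OF \<open>adj x y\<close> \<open>adj u w\<close> _ c(2,3)] by (auto simp: doubleton_eq_iff)
    then show "c \<in> {pt y}" using x by auto
  qed
  moreover have "pt x \<noteq> pt y" using 1(2) by auto
  ultimately have "arc (poly_path (x # y # z # zs))"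
    using IH by (auto intro!: arc_join)
  then show ?case
    using IH by (auto simp: path_image_join polyline_def)
qed (auto simp: polyline_def)

lemma steps_append: "steps (us @ u # ws) = steps (us @ [u]) \<union> steps (u # ws)"
  by (induction us rule: induct_list012) auto

lemma steps_snoc: "xs \<noteq> [] \<Longrightarrow> steps (xs @ [y]) = insert (last xs, y) (steps xs)"
  by (induction xs rule: induct_list012) auto

text \<open>The closing edge is joined to the arc through the other vertices. With only two vertices
  it would retrace the first edge, hence the bound on the length.\<close>

lemma simple_closed_path_polygon:
  assumes "grid_cycle vs" "3 \<le> length vs"
  obtains c where "simple_path c" "pathfinish c = pathstart c" "path_image c = polygon vs"
proof -
  obtain v xs where vs: "vs = v # xs" using assms by (cases vs) auto
  have ne: "xs \<noteq> []" using vs assms(2) by auto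
  then have cyc: "distinct vs" "adj v (hd xs)" "successively adj vs" "adj (last xs) v"
    using assms(1) by (auto simp: vs grid_cycle_Cons successively_Cons)
  have "2 \<le> length vs" using assms(2) by simp
  note p = poly_path[OF cyc(1) this cyc(3)]
  have poly: "polygon vs = polyline vs \<union> closed_segment (pt (last xs)) (pt v)"
    using ne steps_snoc[of "v # xs" v] by (simp add: polyline_def vs Un_commute)
  have "polyline vs \<inter> closed_segment (pt (last xs)) (pt v) \<subseteq> {pt v, pt (last xs)}"
  proof
    fix c assume "c \<in> polyline vs \<inter> closed_segment (pt (last xs)) (pt v)"
    then obtain u w where c: "(u, w) \<in> steps vs" "c \<in> closed_segment (pt (last xs)) (pt v)"
      "c \<in> closed_segment (pt u) (pt w)"
      unfolding polyline_def by blast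
    \<comment> \<open>Only the first edge of the arc contains \<open>v\<close>, and its other end
      \<open>hd xs\<close> differs from \<open>last xs\<close>.\<close>
    have "{last xs, v} \<noteq> {u, w}"
    proof
      assume eq: "{last xs, v} = {u, w}"
      have "hd xs \<noteq> last xs"
        using assms(2) cyc(1) by (cases xs) (auto simp: vs)
      moreover have "steps vs = insert (v, hd xs) (steps xs)"
        using ne by (cases xs) (auto simp: vs)
      moreover have "v \<noteq> hd xs" using cyc(1) ne by (auto simp: vs)
      ultimately have "(u, w) \<in> steps xs" using c(1) eq by (auto simp: doubleton_eq_iff)
      then have "v \<in> set xs" using steps_subset eq by fastforce
      then show False using cyc(1) vs by auto
    qed
    moreover have "adj u w" using c(1) cyc(3) unfolding successively_iff_steps by auto
    ultimately show "c \<in> {pt v, pt (last xs)}"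
      using segments_Int[OF cyc(4) _ _ c(2,3)] by blast
  qed
  moreover have "pt (last xs) \<noteq> pt v" using cyc(1) ne by (auto simp: vs)
  ultimately have "simple_path (poly_path vs +++ linepath (pt (last xs)) (pt v))"
    using p ne by (intro simple_path_join_loop) (auto simp: vs)
  then show ?thesis
    using p ne poly by (intro that) (auto simp: path_image_join vs)
qed

text \<open>The ray starts in the middle of the unit column containing \<open>z\<close> instead of
  at \<open>z\<close> itself, so it never runs along a vertical edge. At a lattice point this is the
  parity of \<open>crossings\<close>.\<close>

definition parity_at :: "(nat \<times> nat) list \<Rightarrow> complex \<Rightarrow> bool" where
  "parity_at vs z \<longleftrightarrow> odd (cycle_sum (crosses \<lfloor>Re z\<rfloor> (Im z)) vs)"

text \<open>Two things can change near \<open>z\<close>: the column, if \<open>z\<close> lies on a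
  vertical grid line, and the comparison with heights equal to \<open>Im z\<close>. Either change
  affects the parity only through an edge that contains \<open>z\<close>.\<close>

lemma parity_at_locally_constant:
  assumes "grid_cycle vs" "z \<notin> polygon vs"
  shows "\<forall>\<^sub>F w in nhds z. parity_at vs z = parity_at vs w"
proof -
  have adj: "successively adj (vs @ [hd vs])" and ne: "vs \<noteq> []"
    using assms(1) by (auto simp: grid_cycle_def)
  have Re: "((\<lambda>w. Re w) \<longlongrightarrow> Re z) (nhds z)" and Im: "((\<lambda>w. Im w) \<longlongrightarrow> Im z) (nhds z)"
    by (auto intro!: tendsto_intros filterlim_ident)
  have "\<forall>\<^sub>F w in nhds z. Re w < of_int \<lfloor>Re z\<rfloor> + 1"
    by (intro order_tendstoD[OF Re]) linarith
  moreover have "\<forall>\<^sub>F w in nhds z. of_int \<lfloor>Re z\<rfloor> - 1 < Re w"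
    by (intro order_tendstoD[OF Re]) linarith
  moreover have "\<forall>\<^sub>F w in nhds z. of_int \<lfloor>Re z\<rfloor> \<noteq> Re z \<longrightarrow> of_int \<lfloor>Re z\<rfloor> < Re w"
  proof (cases "of_int \<lfloor>Re z\<rfloor> = Re z")
    case False
    then have "of_int \<lfloor>Re z\<rfloor> < Re z" by linarith
    from order_tendstoD(1)[OF Re this] show ?thesis by eventually_elim simp
  qed simp
  moreover have "\<forall>\<^sub>F w in nhds z. \<forall>u\<in>set vs. real (snd u) \<noteq> Im z \<longrightarrow>
      (real (snd u) < Im w \<longleftrightarrow> real (snd u) < Im z)"
  proof (intro eventually_ball_finite ballI)
    fix u
    consider "real (snd u) < Im z" | "real (snd u) = Im z" | "real (snd u) > Im z" by linarith
    then show "\<forall>\<^sub>F w in nhds z. real (snd u) \<noteq> Im z \<longrightarrow> (real (snd u) < Im w \<longleftrightarrow> real (snd u) < Im z)"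
    proof cases
      case 1
      from order_tendstoD(1)[OF Im 1] show ?thesis by eventually_elim (use 1 in simp)
    next
      case 3
      from order_tendstoD(2)[OF Im 3] show ?thesis by eventually_elim (use 3 in simp)
    qed simp
  qed simp
  ultimately show ?thesis
  proof eventually_elim
    case (elim w)
    define X where "X = \<lfloor>Re w\<rfloor>"
    \<comment> \<open>A nearby \<open>w\<close> can fall into the column to the left only if
      \<open>Re z\<close> is an integer.\<close>
    have col: "X = \<lfloor>Re z\<rfloor> \<or> X + 1 = \<lfloor>Re z\<rfloor> \<and> of_int (X + 1) = Re z"
    proof (cases "of_int \<lfloor>Re z\<rfloor> \<le> Re w")
      case True
      then have "X = \<lfloor>Re z\<rfloor>" unfolding X_def using elim(1) by linarith
      then show ?thesis by simp
    next
      case False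
      then have "X + 1 = \<lfloor>Re z\<rfloor>" unfolding X_def using elim(2) by linarith
      then show ?thesis using elim(3) False by auto
    qed
    then have X: "of_int X \<le> Re z" "Re z \<le> of_int X + 1" by linarith+
    have off: "z \<notin> closed_segment (pt u) (pt u')" if "(u, u') \<in> steps (vs @ [hd vs])" for u u'
      using assms(2) that unfolding polyline_def by auto
    have "successively (\<lambda>u u'. crosses X (Im w) u u' = crosses X (Im z) u u') (vs @ [hd vs])"
    proof (rule successively_weaken[OF adj])
      fix u u' assume u: "(u, u') \<in> steps (vs @ [hd vs])" "u \<in> set (vs @ [hd vs])" "adj u u'"
      have "u \<in> set vs" using u(2) ne by auto
      have "real (snd u) < Im w \<longleftrightarrow> real (snd u) < Im z"
        if *: "snd u = snd u'" "(int (fst u) \<le> X) \<noteq> (int (fst u') \<le> X)"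
      proof -
        \<comment> \<open>An edge at the height of \<open>z\<close> that spans the column
          \<open>X\<close> would pass through \<open>z\<close>, as \<open>Re z\<close> lies between
          \<open>X\<close> and \<open>X + 1\<close>.\<close>
        have "real (snd u) \<noteq> Im z"
        proof
          assume eq: "real (snd u) = Im z"
          have "int (fst u) = X \<and> fst u' = Suc (fst u) \<or> int (fst u') = X \<and> fst u = Suc (fst u')"
            using * u(3) unfolding adj_def by presburger
          then show False
          proof
            assume "int (fst u) = X \<and> fst u' = Suc (fst u)"
            then have "of_int X = real (fst u)" "u' = (Suc (fst u), snd u)"
              using *(1) by (auto simp: prod_eq_iff)
            then show False
              using off[OF u(1)] mem_segment_horizontal[of z "fst u" "snd u"] eq X by simp
          next
            assume "int (fst u') = X \<and> fst u = Suc (fst u')"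
            then have "of_int X = real (fst u')" "u = (Suc (fst u'), snd u')"
              using *(1) by (auto simp: prod_eq_iff)
            then show False
              using off[OF u(1)] mem_segment_horizontal[of z "fst u'" "snd u'"] eq X
              by (simp add: closed_segment_commute)
          qed
        qed
        then show ?thesis using elim(4) \<open>u \<in> set vs\<close> by blast
      qed
      then show "crosses X (Im w) u u' = crosses X (Im z) u u'"
        unfolding crosses_def by (intro arg_cong[where f = of_bool]) blast
    qed
    from walk_sum_cong[OF this]
    have "parity_at vs w \<longleftrightarrow> odd (cycle_sum (crosses X (Im z)) vs)"
      by (simp add: parity_at_def cycle_sum_def X_def)
    moreover have "odd (cycle_sum (crosses X (Im z)) vs) \<longleftrightarrow> parity_at vs z"
    proof (cases "X = \<lfloor>Re z\<rfloor>")
      case True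
      then show ?thesis by (simp add: parity_at_def)
    next
      case False
      then have X1: "X + 1 = \<lfloor>Re z\<rfloor>" "of_int (X + 1) = Re z" using col by blast+
      have "even (cycle_sum (crosses X (Im z)) vs) \<longleftrightarrow> even (cycle_sum (crosses (X + 1) (Im z)) vs)"
      proof (rule crossings_next_column[OF adj _ ne])
        fix u u' assume u: "(u, u') \<in> steps (vs @ [hd vs])" "adj u u'" "fst u = fst u'" "int (fst u) = X + 1"
        then have Re: "Re z = real (fst u)" using X1 by linarith
        have "snd u' = Suc (snd u) \<or> snd u = Suc (snd u')" using u by (auto simp: adj_def)
        then show "real (snd u) < Im z \<longleftrightarrow> real (snd u') < Im z"
        proof
          assume "snd u' = Suc (snd u)"
          then have "u' = (fst u, Suc (snd u))" using u(3) by (auto simp: prod_eq_iff)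
          then show ?thesis
            using off[OF u(1)] mem_segment_vertical[of z "fst u" "snd u"] Re by auto
        next
          assume "snd u = Suc (snd u')"
          then have "u = (fst u', Suc (snd u'))" using u(3) by (auto simp: prod_eq_iff)
          then show ?thesis
            using off[OF u(1)] mem_segment_vertical[of z "fst u'" "snd u'"] Re u(3)
            by (auto simp: closed_segment_commute)
        qed
      qed
      then show ?thesis by (simp add: parity_at_def X1)
    qed
    ultimately show ?case by simp
  qed
qed

lemma parity_at_connected:
  assumes "grid_cycle vs" "connected S" "S \<inter> polygon vs = {}" "x \<in> S" "y \<in> S"
  shows "parity_at vs x \<longleftrightarrow> parity_at vs y"
proof (rule connected_local_const[OF assms(2,4,5)], intro ballI)
  fix a assume "a \<in> S"
  then have "\<forall>\<^sub>F w in nhds a. parity_at vs a = parity_at vs w"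
    using assms by (intro parity_at_locally_constant) auto
  then show "\<forall>\<^sub>F w in at a within S. parity_at vs a = parity_at vs w"
    by (auto simp: eventually_at_filter elim: eventually_mono)
qed

lemma compact_polyline: "compact (polyline xs)"
proof -
  have "finite (steps xs)" by (induction xs rule: induct_list012) auto
  then show ?thesis unfolding polyline_def by (intro compact_UN) auto
qed

text \<open>The outside is connected and contains a point below the upper half plane, in which the
  whole polygon lies; the ray of that point crosses nothing.\<close>

lemma parity_at_outside:
  assumes "grid_cycle vs" "z \<in> outside (polygon vs)"
  shows "\<not> parity_at vs z"
proof -
  let ?H = "{w :: complex. Im w \<ge> 0}"
  have adj: "successively adj (vs @ [hd vs])"
    using assms(1) by (auto simp: grid_cycle_def)
  have "polygon vs \<subseteq> ?H"
  proof -
    have "closed_segment (pt u) (pt w) \<subseteq> ?H" for u w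
      by (intro closed_segment_subset convex_halfspace_Im_ge) simp_all
    then show ?thesis unfolding polyline_def by blast
  qed
  then have "- ?H \<subseteq> outside (polygon vs)"
    by (intro outside_subset_convex convex_halfspace_Im_ge)
  then have low: "Complex 0 (-1) \<in> outside (polygon vs)" by auto
  have "parity_at vs z \<longleftrightarrow> parity_at vs (Complex 0 (-1))"
    using assms low outside_no_overlap
    by (intro parity_at_connected[OF _ connected_outside[OF compact_imp_bounded[OF compact_polyline]]]) auto
  moreover have "walk_sum (crosses X (-1)) xs = 0" for X xs
    by (induction xs rule: induct_list012) (auto simp: crosses_def)
  ultimately show ?thesis by (simp add: parity_at_def cycle_sum_def)
qed

text \<open>By the Jordan curve theorem the inside is connected, so the parity is constant on it,
  and one odd test point settles its value. The outside is even by
  \<open>parity_at_outside\<close>.\<close>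

lemma inside_polygon_iff:
  assumes "grid_cycle vs" "3 \<le> length vs" "z \<notin> polygon vs"
  shows "z \<in> inside (polygon vs) \<longleftrightarrow> parity_at vs z"
proof -
  obtain c where c: "simple_path c" "pathfinish c = pathstart c" "path_image c = polygon vs"
    using simple_closed_path_polygon[OF assms(1,2)] .
  have conn: "connected (inside (polygon vs))"
    using Jordan_inside_outside[OF c(1,2)] c(3) by simp
  obtain v xs us ws where rot: "vs = us @ ws" "v # xs = ws @ us" "grid_cycle (v # xs)"
    and low: "\<forall>u \<in> set xs. fst v < fst u \<or> fst v = fst u \<and> snd v < snd u"
    by (rule grid_cycle_corner[OF assms(1)])
  have len: "2 \<le> length xs"
    using assms(2) rot(1) arg_cong[OF rot(2), of length] by simp
  \<comment> \<open>The centre of the unit square at the lowest leftmost corner: odd by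
    \<open>corner_crossings\<close>, and off the polygon because every edge has an integer
    coordinate that is constant along it.\<close>
  define f where "f = Complex (real (fst v) + 1/2) (real (snd v) + 1/2)"
  have fl: "\<lfloor>Re f\<rfloor> = int (fst v)" unfolding f_def by (simp; linarith)
  have "cycle_sum (crosses (int (fst v)) (real (snd v) + 1/2)) (v # xs) = 1"
    by (rule corner_crossings[OF rot(3) len low]) auto
  then have "parity_at (v # xs) f"
    using fl by (simp add: parity_at_def) (simp add: f_def)
  then have pf: "parity_at vs f"
    unfolding parity_at_def rot(1,2) by (simp add: cycle_sum_rotate)
  have "f \<notin> polygon vs"
  proof
    assume "f \<in> polygon vs"
    then obtain u w where f: "(u, w) \<in> steps (vs @ [hd vs])" "f \<in> closed_segment (pt u) (pt w)"
      unfolding polyline_def by auto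
    have "adj u w" using assms(1) f(1) by (auto simp: grid_cycle_def successively_iff_steps)
    then show False
    proof (cases rule: adj_cases)
      case (1 i j)
      then have "real (snd v) + 1/2 = real j"
        using mem_edge_horizontal[OF 1 f(2)] by (simp add: f_def)
      then have "real (2 * snd v + 1) = real (2 * j)" by simp
      then have "2 * snd v + 1 = 2 * j" by (simp only: of_nat_eq_iff)
      then show False by presburger
    next
      case (2 i j)
      then have "real (fst v) + 1/2 = real i"
        using mem_edge_vertical[OF 2 f(2)] by (simp add: f_def)
      then have "real (2 * fst v + 1) = real (2 * i)" by simp
      then have "2 * fst v + 1 = 2 * i" by (simp only: of_nat_eq_iff)
      then show False by presburger
    qed
  qed
  moreover have "f \<notin> outside (polygon vs)" using parity_at_outside[OF assms(1)] pf by blast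
  ultimately have "f \<in> inside (polygon vs)" using inside_Un_outside by blast
  then have "parity_at vs w" if "w \<in> inside (polygon vs)" for w
    using parity_at_connected[OF assms(1) conn _ that] inside_no_overlap pf by blast
  then show ?thesis
    using parity_at_outside[OF assms(1)] assms(3) inside_Un_outside by blast
qed

lemma card_inside_polygon:
  assumes "grid_cycle vs" "finite G"
  shows "even (card {r \<in> G. pt r \<in> inside (polygon vs)}) \<longleftrightarrow> even (exterior_crossings G vs)"
proof -
  have ne: "vs \<noteq> []" and cyc: "distinct vs" "2 \<le> length vs" using assms(1) by (auto simp: grid_cycle_def)
  have on: "pt r \<in> polygon vs \<longleftrightarrow> r \<in> set vs" for r
  proof
    assume "pt r \<in> polygon vs"
    then obtain u w where f: "(u, w) \<in> steps (vs @ [hd vs])" "pt r \<in> closed_segment (pt u) (pt w)"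
      unfolding polyline_def by auto
    from f(1) have "adj u w" using assms(1) by (auto simp: grid_cycle_def successively_iff_steps)
    then have "r \<in> set (vs @ [hd vs])"
      using pt_mem_segment[OF _ f(2)] steps_subset[OF f(1)] by blast
    then show "r \<in> set vs" using ne by auto
  next
    assume "r \<in> set vs"
    then obtain us ws where vs: "vs = us @ r # ws" by (meson split_list)
    have "(r, hd (ws @ [x])) \<in> steps (r # ws @ [x])" for x
      by (cases ws) auto
    then have "(r, hd (ws @ [hd vs])) \<in> steps (vs @ [hd vs])"
      using steps_append[of us r "ws @ [hd vs]"] vs by simp
    then show "pt r \<in> polygon vs" unfolding polyline_def by (auto intro!: bexI)
  qed
  have "card {r \<in> G. pt r \<in> inside (polygon vs)} =
    card {r \<in> G - set vs. pt r \<in> inside (polygon vs)}"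
    using inside_no_overlap[of "polygon vs"] on by (intro arg_cong[where f = card]) blast
  also have "\<dots> = (\<Sum>r \<in> G - set vs. of_bool (pt r \<in> inside (polygon vs)))"
    using assms(2) by (simp add: of_bool_def sum.If_cases Int_def)
  also have "even \<dots> \<longleftrightarrow> even (exterior_crossings G vs)"
    unfolding exterior_crossings_def
  proof (intro even_sum_iff)
    fix r assume r: "r \<in> G - set vs"
    show "even (of_bool (pt r \<in> inside (polygon vs))) \<longleftrightarrow> even (crossings r vs)"
    proof (cases "3 \<le> length vs")
      case True
      then show ?thesis
        using inside_polygon_iff[OF assms(1) True, of "pt r"] on[of r] r by (simp add: parity_at_def)
    next
      case False
      then obtain u w where vs: "vs = [u, w]"
        using cyc(2) by (cases vs; cases "tl vs"; cases "tl (tl vs)") auto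
      \<comment> \<open>The drawing of a doubled edge is a segment, hence convex, and encloses
        nothing.\<close>
      then have "inside (polygon vs) = {}"
        by (simp add: polyline_def closed_segment_commute inside_convex)
      then show ?thesis by (auto simp: vs cycle_sum_def crosses_def)
    qed
  qed (use assms(2) in simp)
  finally show ?thesis .
qed

section \<open>Loop configurations and permutations\<close>

text \<open>The functional graph of \<open>p\<close> without its fixed points, which play the part
  of monopoles. It has the type of a union of loops, so configurations and permutations are compared
  as sets of darts.\<close>

definition moved_darts :: "('v \<Rightarrow> 'v) \<Rightarrow> ('v \<times> 'v) set" where
  "moved_darts p = {(v, p v) | v. p v \<noteq> v}"

lemma mem_moved_darts: "(v, w) \<in> moved_darts p \<longleftrightarrow> p v \<noteq> v \<and> w = p v"
  by (auto simp: moved_darts_def)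

lemma moved_darts_inject: "moved_darts p = moved_darts q \<longleftrightarrow> p = q"
proof
  assume eq: "moved_darts p = moved_darts q"
  show "p = q"
  proof
    fix v
    have "p v \<noteq> v \<and> w = p v \<longleftrightarrow> q v \<noteq> v \<and> w = q v" for w
      using eq by (simp flip: mem_moved_darts)
    then show "p v = q v" by metis
  qed
qed simp

lemma Field_moved_darts:
  assumes "p permutes S"
  shows "Field (moved_darts p) = {v. p v \<noteq> v}"
proof -
  have "\<exists>u. p u \<noteq> u \<and> p u = v" if "p v \<noteq> v" for v
    using that permutes_inv_eq[OF assms] permutes_inverses[OF assms] by metis
  then show ?thesis
    using permutes_inj[OF assms]
    by (fastforce simp: moved_darts_def Field_def Domain_iff Range_iff inj_def)
qed

lemma moved_darts_comp:
  assumes "q permutes A" "p permutes B" "A \<inter> B = {}"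
  shows "moved_darts (q \<circ> p) = moved_darts q \<union> moved_darts p"
proof -
  have "(q \<circ> p) v = p v" if "v \<in> B" for v
    using that assms permutes_in_image[OF assms(2)] permutes_not_in[OF assms(1)] by auto
  moreover have "q v = v" if "v \<in> B" for v
    using that assms permutes_not_in[OF assms(1)] by auto
  moreover have "(q \<circ> p) v = q v" "p v = v" if "v \<notin> B" for v
    using that permutes_not_in[OF assms(2)] by auto
  ultimately show ?thesis
    unfolding moved_darts_def by (auto, metis+)
qed

lemma cyclic_darts_eq_steps: "cyclic_darts vs = steps (vs @ [hd vs])"
proof -
  have steps: "steps xs = {(xs ! i, xs ! Suc i) | i. Suc i < length xs}" for xs :: "'a list"
  proof (induction xs rule: induct_list012)
    case (3 x y zs)
    have "{i. Suc i < length (x # y # zs)} = insert 0 (Suc ` {i. Suc i < length (y # zs)})"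
      by (auto simp: image_iff) (metis Suc_less_eq not0_implies_Suc)
    then have "(\<lambda>i. ((x # y # zs) ! i, (x # y # zs) ! Suc i)) ` {i. Suc i < length (x # y # zs)} =
      insert (x, y) ((\<lambda>i. ((y # zs) ! i, (y # zs) ! Suc i)) ` {i. Suc i < length (y # zs)})"
      by (simp add: image_image)
    then show ?case using 3 by (simp add: setcompr_eq_image)
  qed auto
  have "(vs @ [hd vs]) ! Suc i = vs ! (Suc i mod length vs)" if "i < length vs" for i
  proof (cases "Suc i = length vs")
    case True
    then show ?thesis using that hd_conv_nth[of vs] by (cases "vs = []") (simp_all add: nth_append)
  qed (use that in \<open>simp add: nth_append\<close>)
  then show ?thesis
    unfolding cyclic_darts_def steps by (fastforce simp: nth_append)
qed

lemma cyclic_darts_eq_moved_darts: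
  assumes "distinct vs" "2 \<le> length vs"
  shows "cyclic_darts vs = moved_darts (cycle_of_list vs)"
proof -
  have "map (cycle_of_list vs) vs = rotate1 vs"
    using cyclic_rotation[OF assms(1), of 1] by simp
  then have nth: "cycle_of_list vs (vs ! i) = vs ! (Suc i mod length vs)" if "i < length vs" for i
    using that by (metis length_rotate1 nth_map nth_rotate1)
  have "cycle_of_list vs (vs ! i) \<noteq> vs ! i" if "i < length vs" for i
  proof -
    have "Suc i mod length vs < length vs" using that by (intro mod_less_divisor) auto
    moreover have "Suc i mod length vs \<noteq> i"
      using that assms(2) by (cases "Suc i = length vs") auto
    ultimately show ?thesis using that assms(1) by (simp add: nth nth_eq_iff_index_eq)
  qed
  then have "cycle_of_list vs v \<noteq> v \<longleftrightarrow> v \<in> set vs" for v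
    by (metis in_set_conv_nth id_outside_supp)
  then have "moved_darts (cycle_of_list vs) = {(v, cycle_of_list vs v) | v. v \<in> set vs}"
    unfolding moved_darts_def by simp
  also have "\<dots> = cyclic_darts vs"
    unfolding cyclic_darts_def using nth by (fastforce simp: in_set_conv_nth)
  finally show ?thesis by simp
qed

lemma Field_cyclic_darts: "Field (cyclic_darts vs) = set vs"
proof -
  have "set vs \<subseteq> Field (cyclic_darts vs)"
    unfolding cyclic_darts_def Field_def by (force simp: in_set_conv_nth)
  moreover have "cyclic_darts vs \<subseteq> set vs \<times> set vs"
  proof (cases "vs = []")
    case False
    then have "set (vs @ [hd vs]) = set vs" by auto
    then show ?thesis
      unfolding cyclic_darts_eq_steps using steps_subset[of _ _ "vs @ [hd vs]"] by auto
  qed (simp add: cyclic_darts_def)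
  then have "Field (cyclic_darts vs) \<subseteq> set vs" by (auto simp: Field_def)
  ultimately show ?thesis by blast
qed

lemma sign_cycle_of_list:
  assumes "distinct cs"
  shows "sign (cycle_of_list cs) = (-1) ^ (length cs - 1)"
  using assms
proof (induction cs rule: cycle_of_list.induct)
  case (1 i j cs)
  have "sign (Transposition.transpose i j \<circ> cycle_of_list (j # cs)) = sign (Transposition.transpose i j) * sign (cycle_of_list (j # cs))"
    by (intro sign_compose permutation_swap_id permutation_of_cycle)
  moreover have "sign (cycle_of_list (j # cs)) = (-1) ^ length cs" using 1 by simp
  moreover have "i \<noteq> j" using 1 by simp
  ultimately show ?case by (simp add: sign_swap_id comp_def)
qed (simp_all add: sign_id)

text \<open>Going once around the loop from \<open>x\<close> reaches every vertex. This later
  identifies two loops that share a vertex.\<close>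

lemma cyclic_darts_closed:
  assumes "x \<in> set vs" "x \<in> A" "\<And>u w. (u, w) \<in> cyclic_darts vs \<Longrightarrow> u \<in> A \<Longrightarrow> w \<in> A"
  shows "set vs \<subseteq> A"
proof -
  obtain us ws where vs: "vs = us @ x # ws" using split_list[OF assms(1)] by blast
  have "steps (x # ws @ us @ [x]) \<subseteq> cyclic_darts vs"
  proof (cases us)
    case Nil
    then show ?thesis by (simp add: cyclic_darts_eq_steps vs)
  next
    case (Cons u us')
    then show ?thesis
      using steps_append[of "x # ws" u "us' @ [x]"] steps_append[of us x "ws @ [u]"]
      by (auto simp: cyclic_darts_eq_steps vs)
  qed
  then have "successively (\<lambda>u w. u \<in> A \<longrightarrow> w \<in> A) (x # ws @ us @ [x])"
    using assms(3) unfolding successively_iff_steps by blast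
  moreover have "successively (\<lambda>u w. u \<in> A \<longrightarrow> w \<in> A) xs \<Longrightarrow> hd xs \<in> A \<Longrightarrow> set xs \<subseteq> A" for xs
    by (induction xs rule: induct_list012) auto
  ultimately have "set (x # ws @ us @ [x]) \<subseteq> A" using assms(2) by (metis list.sel(1))
  then show ?thesis by (auto simp: vs)
qed

lemma loopsD:
  "l \<in> loops G \<Longrightarrow> \<exists>vs. l = cyclic_darts vs \<and> set vs \<subseteq> verts G \<and> distinct vs \<and>
    2 \<le> length vs \<and> even (length vs)"
  unfolding loops_def by blast

lemma Field_loop_subset: "l \<in> loops G \<Longrightarrow> Field l \<subseteq> verts G"
  by (auto dest!: loopsD simp: Field_cyclic_darts)

text \<open>The cyclic permutations of the disjoint loops are composed one by one. A cycle of even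
  length is an odd permutation, so each loop contributes a factor -1 to the sign.\<close>

lemma config_permutation:
  assumes "finite C" "C \<subseteq> loops G" "pairwise (\<lambda>l l'. disjnt (Field l) (Field l')) C"
  shows "\<exists>p. p permutes (\<Union>l\<in>C. Field l) \<and> moved_darts p = \<Union>C \<and> sign p = (-1) ^ card C"
  using assms
proof (induction C rule: finite_induct)
  case empty
  then show ?case by (auto simp: moved_darts_def sign_id intro!: exI[of _ id])
next
  case (insert l C)
  then obtain p where p: "p permutes (\<Union>l\<in>C. Field l)" "moved_darts p = \<Union>C" "sign p = (-1) ^ card C"
    by (auto simp: pairwise_insert)
  obtain vs where vs: "l = cyclic_darts vs" "distinct vs" "2 \<le> length vs" "even (length vs)"
    using insert.prems(1) loopsD[of l G] by auto
  have fin: "finite (\<Union>l\<in>C. Field l)"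
    using insert.prems(1) insert.hyps(1) by (auto dest!: loopsD simp: Field_cyclic_darts)
  have q: "cycle_of_list vs permutes Field l"
    using cycle_permutes by (simp add: vs(1) Field_cyclic_darts)
  have disj: "Field l \<inter> (\<Union>l\<in>C. Field l) = {}"
    using insert.prems(2) insert.hyps(2) by (auto simp: pairwise_insert disjnt_def)
  have "p permutes (\<Union>l\<in>insert l C. Field l)" "cycle_of_list vs permutes (\<Union>l\<in>insert l C. Field l)"
    by (auto intro: permutes_subset[OF p(1)] permutes_subset[OF q])
  then have "cycle_of_list vs \<circ> p permutes (\<Union>l\<in>insert l C. Field l)"
    by (rule permutes_compose)
  moreover have "moved_darts (cycle_of_list vs \<circ> p) = \<Union>(insert l C)"
    using moved_darts_comp[OF q p(1) disj] cyclic_darts_eq_moved_darts[OF vs(2,3)] p(2) vs(1) by simp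
  moreover have "sign (cycle_of_list vs \<circ> p) = (-1) ^ card (insert l C)"
  proof -
    have "permutation p" using p(1) fin permutation_permutes by blast
    then have "sign (cycle_of_list vs \<circ> p) = (-1) ^ (length vs - 1) * sign p"
      using vs(2) by (simp add: sign_compose permutation_of_cycle sign_cycle_of_list)
    moreover have "odd (length vs - 1)" using vs(3,4) by presburger
    ultimately show ?thesis using insert.hyps p(3) by simp
  qed
  ultimately show ?case by blast
qed

lemma cycle_decomp_permutes: "cycle_decomp I p \<Longrightarrow> p permutes I"
proof (induction rule: cycle_decomp.induct)
  case (comp I p cs)
  have "p permutes set cs \<union> I" "cycle_of_list cs permutes set cs \<union> I"
    by (auto intro: permutes_subset[OF comp.IH] permutes_subset[OF cycle_permutes])
  then show ?case by (rule permutes_compose)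
qed (rule permutes_id)

text \<open>The converse construction, along a cycle decomposition of \<open>p\<close>: each
  nontrivial cycle runs along edges of the graph and becomes a loop, its even length being supplied
  by the last assumption.\<close>

lemma permutation_config:
  assumes "cycle_decomp I p" "I \<subseteq> verts G"
    and "\<And>v. v \<in> I \<Longrightarrow> p v \<noteq> v \<Longrightarrow> {v, p v} \<in> edges G"
    and even: "\<And>vs. set vs \<subseteq> verts G \<Longrightarrow> distinct vs \<Longrightarrow> 2 \<le> length vs \<Longrightarrow>
      (\<And>u w. (u, w) \<in> cyclic_darts vs \<Longrightarrow> {u, w} \<in> edges G) \<Longrightarrow> even (length vs)"
  shows "\<exists>C. C \<in> monopole_dimer_configs G \<and> \<Union>C = moved_darts p"
  using assms(1-3)
proof (induction rule: cycle_decomp.induct)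
  case empty
  then show ?case
    by (auto simp: permutes_id moved_darts_def monopole_dimer_configs_def intro!: exI[of _ "{}"])
next
  case (comp I p cs)
  let ?q = "cycle_of_list cs"
  have q: "?q permutes set cs" by (rule cycle_permutes)
  have p: "p permutes I" by (rule cycle_decomp_permutes[OF comp.hyps(1)])
  have "\<exists>C. C \<in> monopole_dimer_configs G \<and> \<Union>C = moved_darts p"
  proof (rule comp.IH)
    show "I \<subseteq> verts G" using comp.prems(1) by simp
  next
    fix v assume v: "v \<in> I" "p v \<noteq> v"
    then have "p v \<notin> set cs"
      using permutes_in_image[OF p] comp.hyps(3) by blast
    then have "(?q \<circ> p) v = p v" by (simp add: id_outside_supp)
    then show "{v, p v} \<in> edges G" using comp.prems(2)[of v] v by simp
  qed
  then obtain C where C: "C \<in> monopole_dimer_configs G" "\<Union>C = moved_darts p" by blast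
  show ?case
  proof (cases "2 \<le> length cs")
    case False
    \<comment> \<open>The decomposition may contain cycles on at most one point; they are fixed
      points and add no loop.\<close>
    then have "?q = id" by (cases cs; cases "tl cs") auto
    then show ?thesis using C by auto
  next
    case True
    let ?l = "cyclic_darts cs"
    have l: "?l = moved_darts ?q" by (rule cyclic_darts_eq_moved_darts[OF comp.hyps(2) True])
    have mv: "moved_darts (?q \<circ> p) = moved_darts ?q \<union> moved_darts p"
      by (rule moved_darts_comp[OF q p comp.hyps(3)])
    have edges: "{u, w} \<in> edges G" if "(u, w) \<in> ?l" for u w
    proof -
      have "(u, w) \<in> moved_darts (?q \<circ> p)" using that l mv by simp
      then have "w = (?q \<circ> p) u" "(?q \<circ> p) u \<noteq> u" by (auto simp: moved_darts_def)
      moreover have "u \<in> set cs" using that Field_cyclic_darts[of cs] by (auto simp: Field_def)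
      ultimately show ?thesis using comp.prems(2)[of u] by simp
    qed
    have "?l \<in> loops G"
      unfolding loops_def using comp.prems(1) comp.hyps(2) True edges even[of cs] by auto
    moreover have "disjnt (Field ?l) (Field l')" if "l' \<in> C" for l'
    proof -
      have "Field l' \<subseteq> Field (moved_darts p)" using C(2) that by (auto simp: Field_def)
      also have "\<dots> \<subseteq> I" using Field_moved_darts[OF p] permutes_not_in[OF p] by auto
      finally show ?thesis using comp.hyps(3) by (auto simp: Field_cyclic_darts disjnt_def)
    qed
    ultimately have "insert ?l C \<in> monopole_dimer_configs G"
      using C(1) by (auto simp: monopole_dimer_configs_def pairwise_insert disjnt_sym)
    moreover have "\<Union>(insert ?l C) = moved_darts (?q \<circ> p)" using C(2) l mv by simp
    ultimately show ?thesis by blast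
  qed
qed

text \<open>Single-valuedness lets every loop be recovered from one of its vertices by following the
  darts of the union. Two loops from the two configurations that share a dart therefore
  coincide.\<close>

lemma config_eq_of_Union_eq:
  assumes "C \<in> monopole_dimer_configs G" "C' \<in> monopole_dimer_configs G" "\<Union>C = \<Union>C'"
    and "single_valued (\<Union>C)"
  shows "C \<subseteq> C'"
proof
  fix l assume "l \<in> C"
  then obtain vs where vs: "l = cyclic_darts vs" "2 \<le> length vs"
    using assms(1) loopsD[of l G] unfolding monopole_dimer_configs_def by blast
  then have "(vs ! 0, vs ! (Suc 0 mod length vs)) \<in> l" unfolding cyclic_darts_def by force
  then obtain l' where l': "l' \<in> C'" "(vs ! 0, vs ! (Suc 0 mod length vs)) \<in> l'"
    using \<open>l \<in> C\<close> assms(3) by blast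
  then obtain vs' where vs': "l' = cyclic_darts vs'"
    using assms(2) loopsD[of l' G] unfolding monopole_dimer_configs_def by blast
  have x: "vs ! 0 \<in> set vs" "vs ! 0 \<in> set vs'"
  proof -
    show "vs ! 0 \<in> set vs" using vs(2) by (intro nth_mem) linarith
    show "vs ! 0 \<in> set vs'" using l'(2) Field_cyclic_darts[of vs'] by (auto simp: vs' Field_def)
  qed
  have *: "(u, w) \<in> cyclic_darts ys \<longleftrightarrow> u \<in> set ys \<and> (u, w) \<in> \<Union>C"
    if ys: "cyclic_darts ys \<subseteq> \<Union>C" for ys u w
  proof
    assume "u \<in> set ys \<and> (u, w) \<in> \<Union>C"
    moreover from this obtain w' where "(u, w') \<in> cyclic_darts ys"
      unfolding cyclic_darts_def by (force simp: in_set_conv_nth)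
    ultimately show "(u, w) \<in> cyclic_darts ys"
      using ys assms(4) by (metis single_valuedD subsetD)
  next
    assume "(u, w) \<in> cyclic_darts ys"
    then show "u \<in> set ys \<and> (u, w) \<in> \<Union>C"
      using ys Field_cyclic_darts[of ys] by (auto simp: Field_def)
  qed
  have sub: "cyclic_darts vs \<subseteq> \<Union>C" "cyclic_darts vs' \<subseteq> \<Union>C"
    using \<open>l \<in> C\<close> l'(1) assms(3) vs vs' by auto
  have mem: "w \<in> set ys" if "(u, w) \<in> cyclic_darts ys" for u w and ys :: "'a list"
    using that Field_cyclic_darts[of ys] by (auto simp: Field_def)
  have "set vs \<subseteq> set vs'"
    using cyclic_darts_closed[OF x] *[OF sub(1)] *[OF sub(2)] mem by metis
  moreover have "set vs' \<subseteq> set vs"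
    using cyclic_darts_closed[OF x(2,1)] *[OF sub(1)] *[OF sub(2)] mem by metis
  ultimately have "l = l'"
    using *[OF sub(1)] *[OF sub(2)] unfolding vs(1) vs' by auto
  then show "l \<in> C'" using l'(1) by simp
qed

text \<open>The Leibniz formula indexed by the vertices themselves, so that permutations of vertices
  can be compared with configurations without numbering the grid.\<close>

definition set_det :: "'v set \<Rightarrow> ('v \<Rightarrow> 'v \<Rightarrow> real) \<Rightarrow> real" where
  "set_det V K = (\<Sum>p | p permutes V. of_int (sign p) * (\<Prod>v\<in>V. K v (p v)))"

text \<open>The weights agree term by term: the minus sign that \<open>loop\<close> assigns to each
  loop cancels the factor -1 that this loop gives to the sign of the permutation.\<close>

theorem monopole_dimer_partition_eq_set_det:
  assumes fin: "finite (verts G)"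
    and even: "\<And>vs. set vs \<subseteq> verts G \<Longrightarrow> distinct vs \<Longrightarrow> 2 \<le> length vs \<Longrightarrow>
      (\<And>u w. (u, w) \<in> cyclic_darts vs \<Longrightarrow> {u, w} \<in> edges G) \<Longrightarrow> even (length vs)"
    and diag: "\<And>v. v \<in> verts G \<Longrightarrow> K v v = wv v"
    and zero: "\<And>u w. u \<in> verts G \<Longrightarrow> w \<in> verts G \<Longrightarrow> u \<noteq> w \<Longrightarrow> {u, w} \<notin> edges G \<Longrightarrow> K u w = 0"
    and loop: "\<And>l. l \<in> loops G \<Longrightarrow> loop_weight G we l = - (\<Prod>(u, w)\<in>l. K u w)"
  shows "monopole_dimer_partition G we wv = set_det (verts G) K"
proof -
  let ?V = "verts G" and ?Cs = "monopole_dimer_configs G"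
  define term_of where "term_of p = of_int (sign p) * (\<Prod>v\<in>?V. K v (p v))" for p
  \<comment> \<open>The description is unique because \<open>moved_darts\<close> is injective;
    existence comes from \<open>config_permutation\<close>.\<close>
  define perm_of where "perm_of C = (THE p. moved_darts p = \<Union>C)" for C :: "('a \<times> 'a) set set"
  have C_fin: "finite C" if "C \<in> ?Cs" for C
  proof (rule finite_subset)
    show "C \<subseteq> Pow (?V \<times> ?V)"
    proof
      fix l assume "l \<in> C"
      then have "Field l \<subseteq> ?V"
        using that Field_loop_subset[of l G] by (auto simp: monopole_dimer_configs_def)
      then show "l \<in> Pow (?V \<times> ?V)" by (auto simp: Field_def)
    qed
  qed (use fin in simp)
  have perm_of: "perm_of C permutes ?V" "moved_darts (perm_of C) = \<Union>C"
    "sign (perm_of C) = (-1) ^ card C" if C_cfg: "C \<in> ?Cs" for C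
  proof -
    have C: "C \<subseteq> loops G" "pairwise (\<lambda>l l'. disjnt (Field l) (Field l')) C"
      using that by (auto simp: monopole_dimer_configs_def)
    obtain p where p: "p permutes (\<Union>l\<in>C. Field l)" "moved_darts p = \<Union>C" "sign p = (-1) ^ card C"
      using config_permutation[OF C_fin[OF C_cfg] C] by blast
    have "perm_of C = p"
      unfolding perm_of_def p(2)[symmetric] moved_darts_inject by simp
    moreover have "(\<Union>l\<in>C. Field l) \<subseteq> ?V"
      using C(1) Field_loop_subset by blast
    then have "p permutes ?V" using permutes_subset[OF p(1)] by blast
    ultimately show "perm_of C permutes ?V" "moved_darts (perm_of C) = \<Union>C"
      "sign (perm_of C) = (-1) ^ card C" using p by auto
  qed
  have inj: "inj_on perm_of ?Cs"
  proof (rule inj_onI)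
    fix C C' assume CC: "C \<in> ?Cs" "C' \<in> ?Cs" "perm_of C = perm_of C'"
    then have eq: "\<Union>C = \<Union>C'" using perm_of(2) by metis
    have "single_valued (\<Union>C)"
      unfolding perm_of(2)[OF CC(1), symmetric] by (simp add: single_valued_def mem_moved_darts)
    then show "C = C'"
      using config_eq_of_Union_eq CC(1,2) eq by (metis subset_antisym)
  qed
  have weight: "config_weight G we wv C = term_of (perm_of C)" if C: "C \<in> ?Cs" for C
  proof -
    let ?p = "perm_of C"
    have loops: "C \<subseteq> loops G" and disj: "pairwise (\<lambda>l l'. disjnt (Field l) (Field l')) C"
      using C by (auto simp: monopole_dimer_configs_def)
    have mv: "{v. ?p v \<noteq> v} = (\<Union>l\<in>C. Field l)"
      using Field_moved_darts[OF perm_of(1)[OF C]] perm_of(2)[OF C] by (simp add: Field_Union)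
    have sub: "{v. ?p v \<noteq> v} \<subseteq> ?V" using permutes_not_in[OF perm_of(1)[OF C]] by blast
    have "(\<Prod>v\<in>?V. K v (?p v)) =
      (\<Prod>v\<in>{v. ?p v \<noteq> v}. K v (?p v)) * (\<Prod>v\<in>?V - {v. ?p v \<noteq> v}. K v (?p v))"
      unfolding prod.subset_diff[OF sub fin] by (rule mult.commute)
    also have "(\<Prod>v\<in>?V - {v. ?p v \<noteq> v}. K v (?p v)) = (\<Prod>v\<in>?V - (\<Union>l\<in>C. Field l). wv v)"
      unfolding mv[symmetric] by (intro prod.cong) (auto simp: diag)
    also have "(\<Prod>v\<in>{v. ?p v \<noteq> v}. K v (?p v)) = (\<Prod>(u, w)\<in>moved_darts ?p. K u w)"
      by (rule prod.reindex_bij_witness[of _ fst "\<lambda>v. (v, ?p v)"]) (auto simp: moved_darts_def)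
    also have "\<dots> = (\<Prod>l\<in>C. \<Prod>(u, w)\<in>l. K u w)"
      unfolding perm_of(2)[OF C]
    proof (subst prod.Union_disjoint)
      show "\<forall>l\<in>C. finite l"
        using loops by (auto dest!: loopsD simp: cyclic_darts_def)
      show "\<forall>l\<in>C. \<forall>l'\<in>C. l \<noteq> l' \<longrightarrow> l \<inter> l' = {}"
        using disj by (fastforce simp: pairwise_def disjnt_def Field_def)
    qed simp
    also have "\<dots> = (\<Prod>l\<in>C. - loop_weight G we l)"
      using loops by (intro prod.cong) (auto simp: loop)
    also have "\<dots> = (-1) ^ card C * (\<Prod>l\<in>C. loop_weight G we l)"
      by (simp add: prod_uminus)
    finally show ?thesis
      by (simp add: term_of_def perm_of(3)[OF C] config_weight_def)
  qed
  have "monopole_dimer_partition G we wv = (\<Sum>p\<in>perm_of ` ?Cs. term_of p)"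
    using weight inj by (simp add: monopole_dimer_partition_def sum.reindex)
  also have "\<dots> = (\<Sum>p | p permutes ?V. term_of p)"
  proof (rule sum.mono_neutral_left)
    show "finite {p. p permutes ?V}" using fin by (rule finite_permutations)
    show "perm_of ` ?Cs \<subseteq> {p. p permutes ?V}" using perm_of(1) by auto
    show "\<forall>p\<in>{p. p permutes ?V} - perm_of ` ?Cs. term_of p = 0"
    proof (rule ballI, rule ccontr)
      fix p assume p: "p \<in> {p. p permutes ?V} - perm_of ` ?Cs" "term_of p \<noteq> 0"
      then have "K v (p v) \<noteq> 0" if "v \<in> ?V" for v
        using that fin by (auto simp: term_of_def)
      then have e: "{v, p v} \<in> edges G" if "v \<in> ?V" "p v \<noteq> v" for v
        using that zero[of v "p v"] p(1) permutes_in_image[of p ?V v] by auto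
      have pV: "p permutes ?V" using p(1) by simp
      have "\<exists>C. C \<in> ?Cs \<and> \<Union>C = moved_darts p"
        by (rule permutation_config[OF cycle_decomposition[OF pV fin] order_refl]) (fact e, fact even)
      then obtain C where C: "C \<in> ?Cs" "\<Union>C = moved_darts p" by blast
      then have "perm_of C = p" using perm_of(2)[OF C(1)] moved_darts_inject by metis
      then show False using p(1) C(1) by blast
    qed
  qed
  finally show ?thesis by (simp add: set_det_def term_of_def)
qed

section \<open>The signed adjacency matrix of the grid\<close>

text \<open>Distinct starting points mean that no dart is repeated, so the sum over the list is a
  sum over a set. The last entry is left out because a closed walk ends where it began.\<close>

lemma walk_sum_eq_sum_steps:
  "distinct (butlast xs) \<Longrightarrow> walk_sum f xs = (\<Sum>(u, w)\<in>steps xs. f u w)"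
proof (induction xs rule: induct_list012)
  case (3 x y zs)
  have fin: "finite (steps xs)" for xs :: "'a list"
    by (induction xs rule: induct_list012) auto
  have "(u, w) \<in> steps xs \<Longrightarrow> u \<in> set (butlast xs)" for u w and xs :: "'a list"
    by (induction xs rule: induct_list012) auto
  then have "(x, y) \<notin> steps (y # zs)" using 3(3) by fastforce
  then show ?case using 3 fin by simp
qed auto

lemma grid_edges_iff:
  "{u, w} \<in> edges (grid_graph m n) \<longleftrightarrow> u \<in> {1..m} \<times> {1..n} \<and> w \<in> {1..m} \<times> {1..n} \<and> adj u w"
proof
  assume "{u, w} \<in> edges (grid_graph m n)"
  then show "u \<in> {1..m} \<times> {1..n} \<and> w \<in> {1..m} \<times> {1..n} \<and> adj u w"
    by (auto simp: grid_graph_def adj_def doubleton_eq_iff)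
next
  assume *: "u \<in> {1..m} \<times> {1..n} \<and> w \<in> {1..m} \<times> {1..n} \<and> adj u w"
  then have "adj u w" by simp
  then show "{u, w} \<in> edges (grid_graph m n)"
  proof (cases rule: adj_cases)
    case (1 i j)
    then have "(i, j) \<in> {1..m} \<times> {1..n}" "(Suc i, j) \<in> {1..m} \<times> {1..n}"
      using * by (auto simp: doubleton_eq_iff)
    then show ?thesis unfolding 1 by (auto simp: grid_graph_def)
  next
    case (2 i j)
    then have "(i, j) \<in> {1..m} \<times> {1..n}" "(i, Suc j) \<in> {1..m} \<times> {1..n}"
      using * by (auto simp: doubleton_eq_iff)
    then show ?thesis unfolding 2 by (auto simp: grid_graph_def)
  qed
qed

lemma verts_grid_graph: "verts (grid_graph m n) = {1..m} \<times> {1..n}"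
  by (simp add: grid_graph_def)

lemma loop_curve_grid: "loop_curve (grid_graph m n) (cyclic_darts vs) = polygon vs"
  by (simp add: loop_curve_def grid_graph_def polyline_def cyclic_darts_eq_steps pt_def
    segment_convex_hull)

lemma grid_cycleI:
  assumes "distinct vs" "2 \<le> length vs" "\<And>u w. (u, w) \<in> cyclic_darts vs \<Longrightarrow> {u, w} \<in> edges (grid_graph m n)"
  shows "grid_cycle vs"
  using assms grid_edges_iff unfolding grid_cycle_def successively_iff_steps cyclic_darts_eq_steps
  by blast

text \<open>The grid is bipartite: each step changes the parity of the coordinate sum.\<close>

lemma grid_cycle_even_length:
  assumes "grid_cycle vs"
  shows "even (length vs)"
proof -
  let ?g = "\<lambda>u :: nat \<times> nat. fst u + snd u"
  have adj: "successively adj (vs @ [hd vs])" and ne: "vs \<noteq> []"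
    using assms by (auto simp: grid_cycle_def)
  have "successively (\<lambda>u w. even (1 + ?g u + ?g w)) (vs @ [hd vs])"
    by (rule successively_weaken[OF adj]) (auto simp: adj_def)
  then have "even (walk_sum (\<lambda>_ _. 1) (vs @ [hd vs]) + ?g (hd vs) + ?g (hd vs))"
    using walk_sum_coboundary[of "\<lambda>_ _. 1" ?g "vs @ [hd vs]"] ne by simp
  moreover have "xs \<noteq> [] \<Longrightarrow> walk_sum (\<lambda>_ _. 1) xs = length xs - 1" for xs :: "(nat \<times> nat) list"
    by (induction xs rule: induct_list012) auto
  ultimately show ?thesis by simp argo
qed

definition grid_matrix :: "real \<Rightarrow> real \<Rightarrow> real \<Rightarrow> nat \<times> nat \<Rightarrow> nat \<times> nat \<Rightarrow> real" where
  "grid_matrix a b z u w =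
     (if u = w then z else if adj u w then (-1) ^ orient u w * grid_edge_weight a b {u, w} else 0)"

text \<open>The signs along the loop multiply to -1 to the power \<open>cycle_sum orient vs\<close>.
  By \<open>pick_parity\<close> and \<open>card_inside_polygon\<close> this exponent and the number
  of enclosed vertices have opposite parities, which accounts for the minus sign.\<close>

lemma loop_weight_grid:
  assumes "l \<in> loops (grid_graph m n)"
  shows "loop_weight (grid_graph m n) (grid_edge_weight a b) l = - (\<Prod>(u, w)\<in>l. grid_matrix a b z u w)"
proof -
  let ?V = "{1..m} \<times> {1..n}"
  obtain vs where vs: "l = cyclic_darts vs" "set vs \<subseteq> ?V" "distinct vs" "2 \<le> length vs"
    "\<And>u w. (u, w) \<in> cyclic_darts vs \<Longrightarrow> {u, w} \<in> edges (grid_graph m n)"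
    using assms unfolding loops_def verts_grid_graph by blast
  have cyc: "grid_cycle vs" using grid_cycleI vs by blast
  have adj: "adj u w" if "(u, w) \<in> l" for u w using vs(5) that vs(1) grid_edges_iff by blast
  have "(\<Prod>(u, w)\<in>l. grid_matrix a b z u w) =
    (\<Prod>(u, w)\<in>l. (-1) ^ orient u w * grid_edge_weight a b {u, w})"
  proof (intro prod.cong refl)
    fix d assume "d \<in> l"
    then obtain u w where d: "d = (u, w)" "adj u w" using adj by (cases d) auto
    then have "u \<noteq> w" by (auto simp: adj_def)
    then show "(case d of (u, w) \<Rightarrow> grid_matrix a b z u w) =
      (case d of (u, w) \<Rightarrow> (-1) ^ orient u w * grid_edge_weight a b {u, w})"
      using d by (simp add: grid_matrix_def)
  qed
  also have "\<dots> = (-1) ^ (\<Sum>(u, w)\<in>l. orient u w) * (\<Prod>(u, w)\<in>l. grid_edge_weight a b {u, w})"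
    by (simp add: case_prod_beta prod.distrib power_sum)
  also have "(\<Sum>(u, w)\<in>l. orient u w) = cycle_sum orient vs"
    using vs(3) by (simp add: vs(1) cyclic_darts_eq_steps cycle_sum_def walk_sum_eq_sum_steps)
  finally have K: "(\<Prod>(u, w)\<in>l. grid_matrix a b z u w) =
    (-1) ^ cycle_sum orient vs * (\<Prod>(u, w)\<in>l. grid_edge_weight a b {u, w})" .
  have "enclosed (grid_graph m n) l = {r \<in> ?V. pt r \<in> inside (polygon vs)}"
    by (simp add: enclosed_def loop_curve_grid vs(1) verts_grid_graph) (simp add: grid_graph_def pt_def)
  then have "even (card (enclosed (grid_graph m n) l)) \<longleftrightarrow> even (exterior_crossings ?V vs)"
    using card_inside_polygon[OF cyc] by simp
  moreover have "odd (cycle_sum orient vs + exterior_crossings ?V vs)"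
    by (rule pick_parity[OF cyc vs(2)])
  ultimately have "even (card (enclosed (grid_graph m n) l)) \<longleftrightarrow> odd (cycle_sum orient vs)"
    by simp
  then have "(-1 :: real) ^ card (enclosed (grid_graph m n) l) = - ((-1) ^ cycle_sum orient vs)"
    by (auto simp: minus_one_power_iff)
  then show ?thesis by (simp add: loop_weight_def K)
qed

theorem grid_partition_eq_set_det:
  "grid_partition a b z m n = set_det ({1..m} \<times> {1..n}) (grid_matrix a b z)"
proof -
  have "grid_partition a b z m n = set_det (verts (grid_graph m n)) (grid_matrix a b z)"
    unfolding grid_partition_def
  proof (rule monopole_dimer_partition_eq_set_det)
    fix vs :: "(nat \<times> nat) list"
    assume "distinct vs" "2 \<le> length vs"
      "\<And>u w. (u, w) \<in> cyclic_darts vs \<Longrightarrow> {u, w} \<in> edges (grid_graph m n)"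
    then show "even (length vs)" by (intro grid_cycle_even_length grid_cycleI)
  next
    fix u w assume "u \<in> verts (grid_graph m n)" "w \<in> verts (grid_graph m n)" "u \<noteq> w"
      "{u, w} \<notin> edges (grid_graph m n)"
    then show "grid_matrix a b z u w = 0"
      unfolding grid_edges_iff verts_grid_graph grid_matrix_def by simp
  next
    show "loop_weight (grid_graph m n) (grid_edge_weight a b) l = - (\<Prod>(u, w)\<in>l. grid_matrix a b z u w)"
      if "l \<in> loops (grid_graph m n)" for l
      by (rule loop_weight_grid[OF that])
  qed (auto simp: verts_grid_graph grid_matrix_def)
  then show ?thesis by (simp add: verts_grid_graph)
qed

lemma grid_matrix_neighbours:
  "grid_matrix a b z (i, j) (Suc i, j) = b"
  "grid_matrix a b z (Suc i, j) (i, j) = - b"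
  "grid_matrix a b z (i, j) (i, Suc j) = (-1) ^ i * a"
  "grid_matrix a b z (i, Suc j) (i, j) = - ((-1) ^ i * a)"
  by (auto simp: grid_matrix_def adj_def orient_def grid_edge_weight_def doubleton_eq_iff)

section \<open>Determinants over finite index sets\<close>

text \<open>Conjugation with the enumeration \<open>f\<close> matches the permutations and preserves
  their signs. This imports multiplicativity and invariance under transposition from matrix
  determinants.\<close>

lemma set_det_eq_det:
  assumes "bij_betw f {0..<N} V"
  shows "set_det V K = Determinant.det (Matrix.mat N N (\<lambda>(i, j). K (f i) (f j)))"
proof -
  let ?A = "{0..<N}"
  have inj: "inj_on f ?A" using assms by (rule bij_betw_imp_inj_on)
  have "Determinant.det (Matrix.mat N N (\<lambda>(i, j). K (f i) (f j))) =
    (\<Sum>p | p permutes ?A. of_int (sign p) * (\<Prod>i\<in>?A. K (f i) (f (p i))))"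
    unfolding Determinant.det_def
    by (auto intro!: sum.cong prod.cong simp: permutes_in_image)
  also have "\<dots> = set_det V K"
    unfolding set_det_def
  proof (rule sum.reindex_bij_witness[of _ "map_permutation V (inv_into ?A f)" "map_permutation ?A f"])
    fix p assume "p \<in> {p. p permutes ?A}"
    then have p: "p permutes ?A" by simp
    show "map_permutation V (inv_into ?A f) (map_permutation ?A f p) = p"
      by (rule map_permutation_compose_inv[OF assms p]) (use inj in simp)
    show "map_permutation ?A f p \<in> {p. p permutes V}"
      using map_permutation_permutes[OF assms p] by simp
    have "(\<Prod>v\<in>V. K v (map_permutation ?A f p v)) = (\<Prod>i\<in>?A. K (f i) (map_permutation ?A f p (f i)))"
      using prod.reindex_bij_betw[OF assms, of "\<lambda>v. K v (map_permutation ?A f p v)"] by simp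
    also have "\<dots> = (\<Prod>i\<in>?A. K (f i) (f (p i)))"
      using inj by (intro prod.cong) (auto simp: map_permutation_apply)
    finally show "of_int (sign (map_permutation ?A f p)) * (\<Prod>v\<in>V. K v (map_permutation ?A f p v)) =
      of_int (sign p) * (\<Prod>i\<in>?A. K (f i) (f (p i)))"
      using sign_map_permutation[OF inj p] by simp
  next
    fix p assume "p \<in> {p. p permutes V}"
    then have p: "p permutes V" by simp
    have inv: "bij_betw (inv_into ?A f) V ?A" using assms by (rule bij_betw_inv_into)
    show "map_permutation V (inv_into ?A f) p \<in> {p. p permutes ?A}"
      using map_permutation_permutes[OF inv p] by simp
    show "map_permutation ?A f (map_permutation V (inv_into ?A f) p) = p"
      by (rule map_permutation_compose_inv[OF inv p])
        (use assms in \<open>auto simp: bij_betw_def f_inv_into_f\<close>)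
  qed
  finally show ?thesis by simp
qed

lemma set_det_mult:
  assumes "finite V"
  shows "set_det V (\<lambda>u w. \<Sum>x\<in>V. A u x * B x w) = set_det V A * set_det V B"
proof -
  obtain f where f: "bij_betw f {0..<card V} V" using ex_bij_betw_nat_finite[OF assms] by blast
  let ?M = "\<lambda>K. Matrix.mat (card V) (card V) (\<lambda>(i, j). K (f i) (f j))"
  have "(\<Sum>x\<in>V. A u x * B x w) = (\<Sum>i\<in>{0..<card V}. A u (f i) * B (f i) w)" for u w
    using sum.reindex_bij_betw[OF f, of "\<lambda>x. A u x * B x w"] by simp
  then have "?M (\<lambda>u w. \<Sum>x\<in>V. A u x * B x w) = ?M A * ?M B"
    by (intro eq_matI) (auto simp: scalar_prod_def)
  then show ?thesis
    using det_mult[of "?M A" "card V" "?M B"] by (simp add: set_det_eq_det[OF f])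
qed

lemma set_det_transpose:
  assumes "finite V"
  shows "set_det V (\<lambda>u w. A w u) = set_det V A"
proof -
  obtain f where f: "bij_betw f {0..<card V} V" using ex_bij_betw_nat_finite[OF assms] by blast
  let ?M = "\<lambda>K. Matrix.mat (card V) (card V) (\<lambda>(i, j). K (f i) (f j))"
  have "?M (\<lambda>u w. A w u) = transpose_mat (?M A)"
    by (intro eq_matI) auto
  then show ?thesis
    using Determinant.det_transpose[of "?M A" "card V"] by (simp add: set_det_eq_det[OF f])
qed

lemma set_det_cong: "(\<And>u w. u \<in> V \<Longrightarrow> w \<in> V \<Longrightarrow> A u w = B u w) \<Longrightarrow> set_det V A = set_det V B"
  unfolding set_det_def by (intro sum.cong refl arg_cong2[where f = "(*)"] prod.cong)
    (auto simp: permutes_in_image)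

lemma set_det_diagonal:
  assumes "finite V" "\<And>u w. u \<in> V \<Longrightarrow> w \<in> V \<Longrightarrow> u \<noteq> w \<Longrightarrow> A u w = 0"
  shows "set_det V A = (\<Prod>v\<in>V. A v v)"
proof -
  have "set_det V A = (\<Sum>p\<in>{id}. of_int (sign p) * (\<Prod>v\<in>V. A v (p v)))"
    unfolding set_det_def
  proof (rule sum.mono_neutral_right)
    show "\<forall>p\<in>{p. p permutes V} - {id}. of_int (sign p) * (\<Prod>v\<in>V. A v (p v)) = 0"
    proof
      fix p assume p: "p \<in> {p. p permutes V} - {id}"
      then obtain v where "p v \<noteq> v" by (auto simp: fun_eq_iff)
      then have "v \<in> V" "A v (p v) = 0"
        using p assms(2)[of v "p v"] permutes_in_image[of p V v] permutes_not_in[of p V v] by auto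
      then show "of_int (sign p) * (\<Prod>v\<in>V. A v (p v)) = 0"
        using assms(1) by auto
    qed
  qed (use assms(1) in \<open>auto simp: finite_permutations permutes_id\<close>)
  then show ?thesis by (simp add: sign_id)
qed

text \<open>From A W = W D, the determinant of W can be cancelled. It is nonzero because its square
  is the determinant of the Gram matrix of the eigenvectors, which is diagonal with positive
  entries. Hence the eigenvectors need no normalisation.\<close>

lemma set_det_eigenbasis:
  assumes "finite V"
    and eigen: "\<And>u v. u \<in> V \<Longrightarrow> v \<in> V \<Longrightarrow> (\<Sum>w\<in>V. A u w * W w v) = ev v * W u v"
    and orth: "\<And>u v. u \<in> V \<Longrightarrow> v \<in> V \<Longrightarrow> u \<noteq> v \<Longrightarrow> (\<Sum>w\<in>V. W w u * W w v) = 0"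
    and pos: "\<And>v. v \<in> V \<Longrightarrow> 0 < (\<Sum>w\<in>V. W w v * W w v)"
  shows "set_det V A = (\<Prod>v\<in>V. ev v)"
proof -
  let ?D = "\<lambda>u v. if u = v then ev v else 0"
  have "set_det V A * set_det V W = set_det V (\<lambda>u v. \<Sum>w\<in>V. A u w * W w v)"
    by (rule set_det_mult[OF assms(1), symmetric])
  also have "\<dots> = set_det V (\<lambda>u v. \<Sum>w\<in>V. W u w * ?D w v)"
  proof (rule set_det_cong)
    fix u v assume "u \<in> V" "v \<in> V"
    moreover from this have "(\<Sum>w\<in>V. W u w * ?D w v) = W u v * ev v"
      using assms(1) by (simp add: if_distrib[where f = "(*) _"] cong: if_cong)
    ultimately show "(\<Sum>w\<in>V. A u w * W w v) = (\<Sum>w\<in>V. W u w * ?D w v)"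
      by (simp add: eigen)
  qed
  also have "\<dots> = set_det V W * set_det V ?D"
    by (rule set_det_mult[OF assms(1)])
  also have "set_det V ?D = (\<Prod>v\<in>V. ev v)"
    by (subst set_det_diagonal[OF assms(1)]) auto
  finally have *: "set_det V A * set_det V W = (\<Prod>v\<in>V. ev v) * set_det V W"
    by (simp add: mult.commute)
  have "set_det V W * set_det V W = set_det V (\<lambda>u w. \<Sum>x\<in>V. W x u * W x w)"
    using set_det_mult[OF assms(1), of "\<lambda>u w. W w u" W] set_det_transpose[OF assms(1), of W] by simp
  also have "\<dots> = (\<Prod>v\<in>V. \<Sum>x\<in>V. W x v * W x v)"
    by (rule set_det_diagonal[OF assms(1)]) (rule orth)
  also have "\<dots> > 0" by (intro prod_pos ballI pos)
  finally have "set_det V W \<noteq> 0" by auto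
  then show ?thesis using * by simp
qed

section \<open>Spectrum of the grid matrix\<close>

text \<open>The off-diagonal part is antisymmetric and linear in \<open>a\<close> and
  \<open>b\<close>. The action of the transpose can thus be read off from
  \<open>sum_grid_matrix\<close> with negated weights.\<close>

lemma grid_matrix_transpose: "grid_matrix a b z w u = grid_matrix (-a) (-b) z u w"
proof (cases "u = w \<or> \<not> adj u w")
  case False
  then have "adj u w" "u \<noteq> w" by auto
  then show ?thesis
  proof (cases rule: adj_cases)
    case (1 i j)
    then show ?thesis
      by (auto simp: doubleton_eq_iff grid_matrix_neighbours)
  next
    case (2 i j)
    then show ?thesis
      by (auto simp: doubleton_eq_iff grid_matrix_neighbours)
  qed
qed (auto simp: grid_matrix_def adj_sym)

text \<open>The grid is padded by a layer on which \<open>h\<close> vanishes. Every vertex then has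
  all four neighbours, and boundary vertices need no separate formula.\<close>

lemma sum_grid_matrix:
  assumes "i \<in> {1..m}" "j \<in> {1..n}"
    and bdry: "\<And>k. h 0 k = 0" "\<And>k. h (Suc m) k = 0" "\<And>k. h k 0 = 0" "\<And>k. h k (Suc n) = 0"
  shows "(\<Sum>(k, l)\<in>{1..m} \<times> {1..n}. grid_matrix a b z (i, j) (k, l) * h k l) =
    z * h i j + b * (h (Suc i) j - h (i - 1) j) + (-1) ^ i * a * (h i (Suc j) - h i (j - 1))"
proof -
  obtain i' j' where ij: "i = Suc i'" "j = Suc j'"
    using assms(1,2) by (metis One_nat_def Suc_le_D atLeastAtMost_iff)
  let ?f = "\<lambda>(k, l). grid_matrix a b z (i, j) (k, l) * h k l"
  let ?N = "{(i, j), (Suc i, j), (i', j), (i, Suc j), (i, j')}"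
  have "(\<Sum>w\<in>{1..m} \<times> {1..n}. ?f w) = (\<Sum>w\<in>{0..Suc m} \<times> {0..Suc n}. ?f w)"
  proof (rule sum.mono_neutral_left)
    show "\<forall>w\<in>{0..Suc m} \<times> {0..Suc n} - {1..m} \<times> {1..n}. ?f w = 0"
    proof
      fix w assume w: "w \<in> {0..Suc m} \<times> {0..Suc n} - {1..m} \<times> {1..n}"
      obtain k l where kl: "w = (k, l)" by (cases w)
      have "k = 0 \<or> k = Suc m \<or> l = 0 \<or> l = Suc n" using w unfolding kl by auto
      then show "?f w = 0" using bdry kl by auto
    qed
  qed auto
  also have "\<dots> = (\<Sum>w\<in>?N. ?f w)"
  proof (rule sum.mono_neutral_right)
    show "?N \<subseteq> {0..Suc m} \<times> {0..Suc n}" using assms(1,2) ij by auto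
    show "\<forall>w\<in>{0..Suc m} \<times> {0..Suc n} - ?N. ?f w = 0"
    proof
      fix w assume w: "w \<in> {0..Suc m} \<times> {0..Suc n} - ?N"
      obtain k l where kl: "w = (k, l)" by (cases w)
      have "(i, j) \<noteq> w" "\<not> adj (i, j) w" using w ij by (auto simp: adj_def kl)
      then show "?f w = 0" by (auto simp: grid_matrix_def kl)
    qed
  qed simp
  also have "\<dots> = z * h i j + b * (h (Suc i) j - h i' j) + (-1) ^ i * a * (h i (Suc j) - h i j')"
    by (simp add: ij grid_matrix_neighbours algebra_simps) (simp add: grid_matrix_def)
  finally show ?thesis by (simp add: ij)
qed

lemma sin_add_double: "sin (x + 2 * t) + sin x = 2 * cos t * sin (x + t)" for x t :: real
  using sin_add[of "x + t" t] sin_diff[of "x + t" t] by (simp add: algebra_simps)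

text \<open>Twisting by the sign turns the symmetric difference operator, whose eigenvectors are sines,
  into the antisymmetric one.\<close>

definition twisted_sin :: "real \<Rightarrow> nat \<Rightarrow> real" where
  "twisted_sin t k = (-1) ^ (k div 2) * sin (real k * t)"

text \<open>The twist changes sign whenever the index grows by 2, which turns the difference into
  minus the sum of two sines, and \<open>sin_add_double\<close> factors this sum. The alternating
  factor on the right compares the twists at \<open>k\<close> and \<open>Suc k\<close>.\<close>

lemma twisted_sin_diff:
  "twisted_sin t (Suc (Suc k)) - twisted_sin t k = 2 * cos t * (-1) ^ Suc k * twisted_sin t (Suc k)"
proof -
  have sgn: "(-1 :: real) ^ (Suc k div 2) * (-1) ^ k = (-1) ^ (k div 2)"
    by (cases "even k") (auto elim!: evenE oddE simp: power_mult)
  have "twisted_sin t (Suc (Suc k)) - twisted_sin t k =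
    - ((-1) ^ (k div 2) * (sin (real k * t + 2 * t) + sin (real k * t)))"
    by (simp add: twisted_sin_def algebra_simps)
  also have "\<dots> = - ((-1) ^ (k div 2) * (2 * cos t * sin (real k * t + t)))"
    by (simp only: sin_add_double)
  finally have "twisted_sin t (Suc (Suc k)) - twisted_sin t k =
    - ((-1) ^ (k div 2) * (2 * cos t * sin (real k * t + t)))" .
  then show ?thesis
    by (simp add: twisted_sin_def sgn[symmetric] algebra_simps)
qed

lemma twisted_sin_mult: "twisted_sin s k * twisted_sin t k = sin (real k * s) * sin (real k * t)"
proof -
  have "(-1 :: real) ^ (k div 2) * (-1) ^ (k div 2) = 1" by (simp flip: power_mult_distrib)
  then show ?thesis by (simp add: twisted_sin_def algebra_simps)
qed

text \<open>The transpose acts on the product of twisted sines as multiplication by the function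
  \<open>c\<close> defined below. Applying the matrix itself to the result removes the dependence on
  the position.\<close>

lemma grid_matrix_eigenvector:
  fixes s t :: real
  assumes "u \<in> {1..m} \<times> {1..n}" "sin (real (Suc m) * s) = 0" "sin (real (Suc n) * t) = 0"
  defines "\<phi> \<equiv> \<lambda>u. twisted_sin s (fst u) * twisted_sin t (snd u)"
  shows "(\<Sum>w\<in>{1..m} \<times> {1..n}. (\<Sum>x\<in>{1..m} \<times> {1..n}.
      grid_matrix a b z u x * grid_matrix a b z w x) * \<phi> w) =
    (z\<^sup>2 + 4 * a\<^sup>2 * (cos t)\<^sup>2 + 4 * b\<^sup>2 * (cos s)\<^sup>2) * \<phi> u"
proof -
  let ?V = "{1..m} \<times> {1..n}" and ?K = "grid_matrix a b z"
  define h where "h k l = twisted_sin s k * twisted_sin t l" for k l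
  \<comment> \<open>The signs come from \<open>twisted_sin_diff\<close> in the two directions; the
    factor \<open>(-1) ^ (k + l)\<close> combines the sign of the vertical edges in column
    \<open>k\<close> with that of the vertical difference.\<close>
  define c where "c k l = z - 2 * b * cos s * (-1) ^ k - 2 * a * cos t * (-1) ^ (k + l)" for k l :: nat
  have bd: "h 0 k = 0" "h (Suc m) k = 0" "h k 0 = 0" "h k (Suc n) = 0" for k
    using assms(2,3) by (simp_all add: h_def twisted_sin_def)
  have h1: "h (Suc i) j - h (i - 1) j = 2 * cos s * (-1) ^ i * h i j" if "1 \<le> i" for i j
    using twisted_sin_diff[of s "i - 1"] that by (simp add: h_def algebra_simps flip: left_diff_distrib)
  have h2: "h i (Suc j) - h i (j - 1) = 2 * cos t * (-1) ^ j * h i j" if "1 \<le> j" for i j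
    using twisted_sin_diff[of t "j - 1"] that by (simp add: h_def algebra_simps flip: right_diff_distrib)
  have step1: "(\<Sum>w\<in>?V. ?K w x * \<phi> w) = c (fst x) (snd x) * h (fst x) (snd x)" if xV: "x \<in> ?V" for x
  proof -
    obtain i j where x: "x = (i, j)" "i \<in> {1..m}" "j \<in> {1..n}" using xV by (cases x) auto
    have "(\<Sum>w\<in>?V. ?K w x * \<phi> w) = (\<Sum>(k, l)\<in>?V. grid_matrix (-a) (-b) z (i, j) (k, l) * h k l)"
      by (intro sum.cong) (auto simp: grid_matrix_transpose[of a b z] x \<phi>_def h_def)
    also have "\<dots> = c i j * h i j"
      unfolding sum_grid_matrix[OF x(2,3) bd]
      using x h1[of i j] h2[of j i] by (simp add: c_def algebra_simps power_add)
    finally show ?thesis by (simp add: x)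
  qed
  obtain i j where u: "u = (i, j)" "i \<in> {1..m}" "j \<in> {1..n}" using assms(1) by (cases u) auto
  have "(\<Sum>w\<in>?V. (\<Sum>x\<in>?V. ?K u x * ?K w x) * \<phi> w) = (\<Sum>w\<in>?V. \<Sum>x\<in>?V. ?K u x * (?K w x * \<phi> w))"
    by (simp add: sum_distrib_right mult.assoc)
  also have "\<dots> = (\<Sum>x\<in>?V. ?K u x * (\<Sum>w\<in>?V. ?K w x * \<phi> w))"
    by (subst sum.swap) (simp add: sum_distrib_left)
  also have "\<dots> = (\<Sum>(k, l)\<in>?V. ?K (i, j) (k, l) * (c k l * h k l))"
  proof (rule sum.cong[OF refl])
    fix x assume "x \<in> ?V"
    from step1[OF this]
    show "?K u x * (\<Sum>w\<in>?V. ?K w x * \<phi> w) = (case x of (k, l) \<Rightarrow> ?K (i, j) (k, l) * (c k l * h k l))"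
      by (simp only: u split: prod.split) simp
  qed
  also have "\<dots> = z * (c i j * h i j) + b * (c (Suc i) j * h (Suc i) j - c (i - 1) j * h (i - 1) j) +
    (-1) ^ i * a * (c i (Suc j) * h i (Suc j) - c i (j - 1) * h i (j - 1))"
    by (rule sum_grid_matrix[OF u(2,3)]) (simp_all add: bd)
  also have "\<dots> = (z\<^sup>2 + 4 * a\<^sup>2 * (cos t)\<^sup>2 + 4 * b\<^sup>2 * (cos s)\<^sup>2) * h i j"
  proof -
    define x y :: real where "x = (-1) ^ i" and "y = (-1) ^ j"
    have xx: "x * x = 1" "y * y = 1"
      by (simp_all add: x_def y_def flip: power_mult_distrib)
    obtain i' j' where ij: "i = Suc i'" "j = Suc j'"
      using u(2,3) by (metis One_nat_def Suc_le_D atLeastAtMost_iff)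
    \<comment> \<open>The factor \<open>c\<close> takes equal values at the left and right
      neighbours, and equal values at the lower and upper ones. It can therefore be pulled out of
      both differences.\<close>
    have c: "c i j = z - 2 * b * cos s * x - 2 * a * cos t * (x * y)"
      "c (Suc i) j = z + 2 * b * cos s * x + 2 * a * cos t * (x * y)"
      "c (i - 1) j = z + 2 * b * cos s * x + 2 * a * cos t * (x * y)"
      "c i (Suc j) = z - 2 * b * cos s * x + 2 * a * cos t * (x * y)"
      "c i (j - 1) = z - 2 * b * cos s * x + 2 * a * cos t * (x * y)"
      by (simp_all add: c_def x_def y_def ij power_add)
    have d: "h (Suc i) j - h (i - 1) j = 2 * cos s * x * h i j"
      "h i (Suc j) - h i (j - 1) = 2 * cos t * y * h i j"
      using h1[of i j] h2[of j i] u(2,3) by (simp_all add: x_def y_def)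
    have "z * (c i j * h i j) + b * (c (Suc i) j * h (Suc i) j - c (i - 1) j * h (i - 1) j) +
      (-1) ^ i * a * (c i (Suc j) * h i (Suc j) - c i (j - 1) * h i (j - 1)) =
      z * (c i j * h i j) +
      b * ((z + 2 * b * cos s * x + 2 * a * cos t * (x * y)) * (h (Suc i) j - h (i - 1) j)) +
      x * a * ((z - 2 * b * cos s * x + 2 * a * cos t * (x * y)) * (h i (Suc j) - h i (j - 1)))"
      unfolding c x_def[symmetric] by (simp only: right_diff_distrib)
    \<comment> \<open>The last summand is zero; it displays the cancellation of the mixed terms in
      \<open>a * b\<close>. The terms linear in \<open>z\<close> cancel as well.\<close>
    also have "\<dots> = (z\<^sup>2 + 4 * a\<^sup>2 * (cos t)\<^sup>2 * ((x * x) * (y * y)) + 4 * b\<^sup>2 * (cos s)\<^sup>2 * (x * x)) * h i j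
      + 4 * a * b * cos s * cos t * h i j * y * (x * x - x * x)"
      unfolding c d by (simp add: algebra_simps power2_eq_square)
    finally show ?thesis by (simp add: xx)
  qed
  finally show ?thesis by (simp add: \<phi>_def h_def u)
qed

text \<open>Discrete Lagrange identity: both sequences solve the recurrence of the second
  difference, with different eigenvalues, so the product sum telescopes to boundary terms, which
  vanish.\<close>

lemma sin_orthogonal:
  fixes s t :: real
  assumes "sin (real (Suc m) * s) = 0" "sin (real (Suc m) * t) = 0" "cos s \<noteq> cos t"
  shows "(\<Sum>k=1..m. sin (real k * s) * sin (real k * t)) = 0"
proof -
  \<comment> \<open>The Casoratian, the discrete Wronskian, of the two sine sequences.\<close>
  define H where "H k = sin (real (Suc k) * s) * sin (real k * t) - sin (real k * s) * sin (real (Suc k) * t)" for k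
  have rec: "sin (real (Suc (Suc k)) * r) = 2 * cos r * sin (real (Suc k) * r) - sin (real k * r)"
    for k and r :: real
    using sin_add_double[of "real k * r" r] by (simp add: algebra_simps)
  have "H (Suc k) - H k = 2 * (cos s - cos t) * (sin (real (Suc k) * s) * sin (real (Suc k) * t))" for k
    unfolding H_def rec by (simp add: algebra_simps del: of_nat_Suc)
  then have "(\<Sum>k<m. 2 * (cos s - cos t) * (sin (real (Suc k) * s) * sin (real (Suc k) * t))) = H m - H 0"
    by (simp flip: sum_lessThan_telescope)
  also have "\<dots> = 0" using assms(1,2) by (simp add: H_def)
  finally have "2 * (cos s - cos t) * (\<Sum>k<m. sin (real (Suc k) * s) * sin (real (Suc k) * t)) = 0"
    by (simp add: sum_distrib_left)
  then have "(\<Sum>k<m. sin (real (Suc k) * s) * sin (real (Suc k) * t)) = 0" using assms(3) by simp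
  moreover have "(\<Sum>k=1..m. sin (real k * s) * sin (real k * t)) =
    (\<Sum>k<m. sin (real (Suc k) * s) * sin (real (Suc k) * t))"
    by (rule sum.reindex_bij_witness[of _ Suc "\<lambda>k. k - 1"]) auto
  ultimately show ?thesis by simp
qed

lemma sin_lattice_boundary: "sin (real (Suc m) * (real p * pi / real (Suc m))) = 0"
proof -
  have "real (Suc m) * (real p * pi / real (Suc m)) = real p * pi" by (simp del: of_nat_Suc)
  then show ?thesis by (simp only: sin_npi)
qed

lemma lattice_angle_bounds:
  assumes "p \<in> {1..m}"
  shows "0 < real p * pi / real (Suc m)" "real p * pi / real (Suc m) < pi"
proof -
  show "0 < real p * pi / real (Suc m)" using assms by (intro divide_pos_pos mult_pos_pos) auto
  have "real p * pi < real (Suc m) * pi" using assms by (intro mult_strict_right_mono) auto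
  then show "real p * pi / real (Suc m) < pi"
    by (simp only: pos_divide_less_eq of_nat_0_less_iff zero_less_Suc mult.commute)
qed

lemma twisted_sin_orthogonal:
  assumes "p \<in> {1..m}" "q \<in> {1..m}" "p \<noteq> q"
  shows "(\<Sum>k=1..m. twisted_sin (real p * pi / real (Suc m)) k * twisted_sin (real q * pi / real (Suc m)) k) = 0"
  unfolding twisted_sin_mult
proof (rule sin_orthogonal[OF sin_lattice_boundary sin_lattice_boundary])
  show "cos (real p * pi / real (Suc m)) \<noteq> cos (real q * pi / real (Suc m))"
  proof
    assume eq: "cos (real p * pi / real (Suc m)) = cos (real q * pi / real (Suc m))"
    have "real p * pi / real (Suc m) = real q * pi / real (Suc m)"
      by (rule cos_inj_pi[OF _ _ _ _ eq]) (use lattice_angle_bounds assms in \<open>auto intro: less_imp_le\<close>)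
    then have "real p * pi = real q * pi" by (simp only: divide_cancel_right of_nat_eq_0_iff) simp
    then show False using assms(3) by simp
  qed
qed

lemma twisted_sin_norm:
  assumes "p \<in> {1..m}"
  shows "0 < (\<Sum>k=1..m. twisted_sin (real p * pi / real (Suc m)) k * twisted_sin (real p * pi / real (Suc m)) k)"
proof (rule sum_pos2)
  show "1 \<in> {1..m}" using assms by auto
  \<comment> \<open>All terms are squares, so it suffices that the first one is positive.\<close>
  have "0 < sin (real p * pi / real (Suc m))"
    by (intro sin_gt_zero lattice_angle_bounds assms)
  then show "0 < twisted_sin (real p * pi / real (Suc m)) 1 * twisted_sin (real p * pi / real (Suc m)) 1"
    unfolding twisted_sin_mult of_nat_1 mult_1 by (intro mult_pos_pos)
qed (simp_all add: twisted_sin_mult)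

text \<open>The frequencies \<open>(p, q)\<close> range over the grid itself, so \<open>W\<close> is
  a square array. Its Gram matrix is a product of two one-dimensional ones, and orthogonality
  follows as soon as one coordinate of the frequencies differs.\<close>

theorem set_det_grid_matrix_square:
  "(set_det ({1..m} \<times> {1..n}) (grid_matrix a b z))\<^sup>2 =
    (\<Prod>(p, q)\<in>{1..m} \<times> {1..n}. z\<^sup>2 + 4 * a\<^sup>2 * (cos (real q * pi / real (Suc n)))\<^sup>2 +
      4 * b\<^sup>2 * (cos (real p * pi / real (Suc m)))\<^sup>2)"
proof -
  let ?V = "{1..m} \<times> {1..n}" and ?K = "grid_matrix a b z"
  let ?s = "\<lambda>p. real p * pi / real (Suc m)" and ?t = "\<lambda>q. real q * pi / real (Suc n)"
  define W where "W u v = twisted_sin (?s (fst v)) (fst u) * twisted_sin (?t (snd v)) (snd u)"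
    for u v :: "nat \<times> nat"
  have W: "(\<Sum>w\<in>?V. W w u * W w v) =
    (\<Sum>k=1..m. twisted_sin (?s (fst u)) k * twisted_sin (?s (fst v)) k) *
    (\<Sum>l=1..n. twisted_sin (?t (snd u)) l * twisted_sin (?t (snd v)) l)" for u v
    unfolding sum_product sum.cartesian_product by (intro sum.cong) (auto simp: W_def)
  have "(set_det ?V ?K)\<^sup>2 = set_det ?V (\<lambda>u w. \<Sum>x\<in>?V. ?K u x * ?K w x)"
    using set_det_mult[of ?V ?K "\<lambda>u w. ?K w u"] set_det_transpose[of ?V ?K]
    by (simp add: power2_eq_square)
  also have "\<dots> = (\<Prod>v\<in>?V. z\<^sup>2 + 4 * a\<^sup>2 * (cos (?t (snd v)))\<^sup>2 + 4 * b\<^sup>2 * (cos (?s (fst v)))\<^sup>2)"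
  proof (rule set_det_eigenbasis[where W = W])
    fix u v assume "u \<in> ?V" "v \<in> ?V"
    then show "(\<Sum>w\<in>?V. (\<Sum>x\<in>?V. ?K u x * ?K w x) * W w v) =
      (z\<^sup>2 + 4 * a\<^sup>2 * (cos (?t (snd v)))\<^sup>2 + 4 * b\<^sup>2 * (cos (?s (fst v)))\<^sup>2) * W u v"
      unfolding W_def by (intro grid_matrix_eigenvector sin_lattice_boundary)
  next
    fix u v assume "u \<in> ?V" "v \<in> ?V" "u \<noteq> v"
    then have mem: "fst u \<in> {1..m}" "fst v \<in> {1..m}" "snd u \<in> {1..n}" "snd v \<in> {1..n}"
      and "fst u \<noteq> fst v \<or> snd u \<noteq> snd v"
      by (auto simp: prod_eq_iff)
    then show "(\<Sum>w\<in>?V. W w u * W w v) = 0"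
      unfolding W by (elim disjE)
        (simp_all only: twisted_sin_orthogonal[OF mem(1,2)] twisted_sin_orthogonal[OF mem(3,4)]
          not_False_eq_True mult_zero_left mult_zero_right)
  next
    fix v assume "v \<in> ?V"
    then have "fst v \<in> {1..m}" "snd v \<in> {1..n}" by auto
    then show "0 < (\<Sum>w\<in>?V. W w v * W w v)"
      unfolding W by (intro mult_pos_pos twisted_sin_norm)
  qed simp
  finally show ?thesis by (simp add: case_prod_beta)
qed

lemma set_det_grid_matrix_pos:
  assumes "z > 0"
  shows "set_det ({1..m} \<times> {1..n}) (grid_matrix a b z) > 0"
proof (rule ccontr)
  let ?V = "{1..m} \<times> {1..n}"
  \<comment> \<open>At \<open>r = 0\<close> only the configuration of monopoles alone survives. At a
    zero of \<open>f\<close> the product formula would have to vanish, although each factor is at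
    least the square of \<open>z\<close>.\<close>
  define f where "f r = set_det ?V (grid_matrix (r * a) (r * b) z)" for r
  assume "\<not> 0 < set_det ?V (grid_matrix a b z)"
  then have "f 1 \<le> 0" by (simp add: f_def)
  moreover have "f 0 = (\<Prod>v\<in>?V. z)"
    unfolding f_def by (subst set_det_diagonal) (auto simp: grid_matrix_def grid_edge_weight_def)
  then have "f 0 > 0" using assms by simp
  moreover have "isCont f r" for r
  proof -
    have "isCont (\<lambda>r. grid_matrix (r * a) (r * b) z u w) r" for u w
      unfolding grid_matrix_def grid_edge_weight_def
      by (cases "u = w"; cases "adj u w"; cases "\<exists>i j. {u, w} = {(i, j), (i, j + 1)}") simp_all
    then show ?thesis unfolding f_def set_det_def by (intro continuous_intros)
  qed
  ultimately obtain r where "f r = 0" using IVT2[of f 1 0 0] by auto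
  then have "(f r)\<^sup>2 = 0" by simp
  moreover have "(f r)\<^sup>2 > 0"
    unfolding f_def set_det_grid_matrix_square
    using assms by (intro prod_pos) (auto intro!: add_pos_nonneg)
  ultimately show False by simp
qed

section \<open>Riemann sums\<close>

text \<open>An explicit error bound instead of mere convergence, since the double sum below needs an
  estimate of the inner sums uniform in the outer variable. The first summand of the bound collects
  the errors of the cells, the second one a missing sample.\<close>

lemma Riemann_sum_error:
  fixes g :: "real \<Rightarrow> real"
  assumes lip: "\<And>x y. \<bar>g x - g y\<bar> \<le> L * \<bar>x - y\<bar>" and bound: "\<And>x. \<bar>g x\<bar> \<le> M" and "0 \<le> c"
  shows "\<bar>c / real (Suc m) * (\<Sum>k=1..m. g (real k * c / real (Suc m))) - integral {0..c} g\<bar>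
    \<le> (L * c\<^sup>2 + M * c) / real (Suc m)"
proof -
  define h where "h = c / real (Suc m)"
  have h: "0 \<le> h" "real (Suc m) * h = c" using assms(3) by (simp_all add: h_def del: of_nat_Suc)
  have L: "0 \<le> L" using lip[of 0 1] by simp
  have cont: "continuous_on A g" for A
    by (rule lipschitz_on_continuous_on[of L]) (auto intro!: lipschitz_onI simp: dist_real_def lip L)
  have step: "\<bar>integral {u..u + h} g - h * g u\<bar> \<le> L * h * h" for u
  proof -
    have "norm (integral {u..u + h} (\<lambda>x. g x - g u)) \<le> L * h * (u + h - u)"
    proof (rule integral_bound)
      fix x assume x: "x \<in> {u..u + h}"
      have "\<bar>g x - g u\<bar> \<le> L * \<bar>x - u\<bar>" by (rule lip)
      also have "\<dots> \<le> L * h" using x L by (intro mult_left_mono) auto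
      finally show "norm (g x - g u) \<le> L * h" by simp
    qed (use h in \<open>auto intro!: continuous_intros cont\<close>)
    moreover have "integral {u..u + h} (\<lambda>x. g x - g u) = integral {u..u + h} g - h * g u"
      using h by (subst integral_diff) (auto intro!: integrable_continuous_interval cont)
    ultimately show ?thesis by simp
  qed
  have "\<bar>integral {0..real j * h} g - (\<Sum>k<j. h * g (real k * h))\<bar> \<le> real j * (L * h * h)" for j
  proof (induction j)
    case (Suc j)
    have "integral {0..real j * h} g + integral {real j * h..real (Suc j) * h} g = integral {0..real (Suc j) * h} g"
      using h by (intro Henstock_Kurzweil_Integration.integral_combine) (auto intro!: integrable_continuous_interval cont simp: mult_right_mono)
    moreover have "real (Suc j) * h = real j * h + h" by (simp add: algebra_simps)
    ultimately show ?case
      using Suc step[of "real j * h"] by (simp add: algebra_simps)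
  qed simp
  note bnd = this[of "Suc m"]
  have "real (Suc m) * (L * h * h) = c * (L * h)" unfolding h(2)[symmetric] by (simp only: mult_ac)
  with bnd have "\<bar>integral {0..c} g - (\<Sum>k<Suc m. h * g (real k * h))\<bar> \<le> c * (L * h)"
    by (simp only: h(2))
  \<comment> \<open>There are m+1 cells but only m samples: the left endpoint 0 is missing and costs
    at most \<open>h * M\<close>.\<close>
  moreover have "(\<Sum>k<Suc m. h * g (real k * h)) = h * g 0 + (\<Sum>k=1..m. h * g (real k * h))"
  proof -
    have "{..<Suc m} = insert 0 {1..m}" by auto
    then show ?thesis by simp
  qed
  moreover have "\<bar>h * g 0\<bar> \<le> h * M"
    using h bound[of 0] by (simp add: abs_mult mult_left_mono)
  ultimately have "\<bar>h * (\<Sum>k=1..m. g (real k * h)) - integral {0..c} g\<bar> \<le> c * (L * h) + h * M"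
    by (simp add: sum_distrib_left)
  also have "\<dots> = (L * c\<^sup>2 + M * c) / real (Suc m)"
    by (simp add: h_def add_divide_distrib power2_eq_square mult_ac del: of_nat_Suc)
  finally show ?thesis by (simp add: h_def)
qed

text \<open>The one-dimensional bound is used for every inner sum and then once for the outer sum of
  the partial integral \<open>I\<close>. The latter is Lipschitz with constant \<open>L * c\<close>
  and bounded by \<open>M * c\<close>, whence the additional factor \<open>c\<close>.\<close>

lemma double_Riemann_sum_error:
  fixes F :: "real \<Rightarrow> real \<Rightarrow> real"
  assumes lip1: "\<And>x y t. \<bar>F x t - F y t\<bar> \<le> L * \<bar>x - y\<bar>"
    and lip2: "\<And>x y s. \<bar>F s x - F s y\<bar> \<le> L * \<bar>x - y\<bar>"
    and bound: "\<And>s t. \<bar>F s t\<bar> \<le> M" and c: "0 \<le> c"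
  shows "\<bar>c / real (Suc n) * (c / real (Suc m)) *
      (\<Sum>q=1..n. \<Sum>p=1..m. F (real q * c / real (Suc n)) (real p * c / real (Suc m))) -
      integral {0..c} (\<lambda>s. integral {0..c} (F s))\<bar>
    \<le> c * (L * c\<^sup>2 + M * c) / real (Suc m) + c * (L * c\<^sup>2 + M * c) / real (Suc n)"
proof -
  define I where "I s = integral {0..c} (F s)" for s
  define C where "C = L * c\<^sup>2 + M * c"
  have L: "0 \<le> L" using lip1[of 0 0 1] by simp
  have M: "0 \<le> M" using bound[of 0 0] by simp
  have C: "0 \<le> C" using L M c by (simp add: C_def)
  have cont: "continuous_on A (F s)" for A s
    by (rule lipschitz_on_continuous_on[of L]) (auto intro!: lipschitz_onI simp: dist_real_def lip2 L)
  have I_lip: "\<bar>I x - I y\<bar> \<le> (L * c) * \<bar>x - y\<bar>" for x y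
  proof -
    have "I x - I y = integral {0..c} (\<lambda>t. F x t - F y t)"
      unfolding I_def by (rule integral_diff[symmetric]) (auto intro!: integrable_continuous_interval cont)
    moreover have "norm (integral {0..c} (\<lambda>t. F x t - F y t)) \<le> L * \<bar>x - y\<bar> * (c - 0)"
      using c lip1 by (intro integral_bound) (auto intro!: continuous_intros cont)
    ultimately show ?thesis by (simp add: mult_ac)
  qed
  have I_bound: "\<bar>I x\<bar> \<le> M * c" for x
  proof -
    have "norm (integral {0..c} (F x)) \<le> M * (c - 0)"
      using c bound by (intro integral_bound cont) auto
    then show ?thesis by (simp add: I_def)
  qed
  define a where "a q = c / real (Suc m) * (\<Sum>p=1..m. F (real q * c / real (Suc n)) (real p * c / real (Suc m)))" for q
  have inner: "\<bar>a q - I (real q * c / real (Suc n))\<bar> \<le> C / real (Suc m)" for q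
    unfolding a_def I_def C_def by (rule Riemann_sum_error[OF lip2 bound c])
  have "\<bar>c / real (Suc n) * (\<Sum>q=1..n. I (real q * c / real (Suc n))) - integral {0..c} I\<bar> \<le> (L * c * c\<^sup>2 + M * c * c) / real (Suc n)"
    by (rule Riemann_sum_error[OF I_lip I_bound c])
  also have "L * c * c\<^sup>2 + M * c * c = c * C" by (simp add: C_def algebra_simps)
  finally have outer: "\<bar>c / real (Suc n) * (\<Sum>q=1..n. I (real q * c / real (Suc n))) - integral {0..c} I\<bar> \<le> c * C / real (Suc n)" .
  have "\<bar>c / real (Suc n) * (\<Sum>q=1..n. a q) - c / real (Suc n) * (\<Sum>q=1..n. I (real q * c / real (Suc n)))\<bar>
    = c / real (Suc n) * \<bar>\<Sum>q=1..n. a q - I (real q * c / real (Suc n))\<bar>"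
    unfolding right_diff_distrib[symmetric] sum_subtractf[symmetric] abs_mult
    using c by (simp only: abs_of_nonneg divide_nonneg_nonneg of_nat_0_le_iff)
  also have "\<dots> \<le> c / real (Suc n) * (\<Sum>q=1..n. C / real (Suc m))"
    using c by (intro mult_left_mono order_trans[OF sum_abs] sum_mono inner) auto
  also have "\<dots> = real n / real (Suc n) * (c * C / real (Suc m))" by simp
  also have "\<dots> \<le> 1 * (c * C / real (Suc m))"
    using c C by (intro mult_right_mono) auto
  finally have "\<bar>c / real (Suc n) * (\<Sum>q=1..n. a q) - c / real (Suc n) * (\<Sum>q=1..n. I (real q * c / real (Suc n)))\<bar>
    \<le> c * C / real (Suc m)" by simp
  with outer have "\<bar>c / real (Suc n) * (\<Sum>q=1..n. a q) - integral {0..c} I\<bar>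
    \<le> c * C / real (Suc m) + c * C / real (Suc n)" by linarith
  moreover have "c / real (Suc n) * (\<Sum>q=1..n. a q) = c / real (Suc n) * (c / real (Suc m)) *
      (\<Sum>q=1..n. \<Sum>p=1..m. F (real q * c / real (Suc n)) (real p * c / real (Suc m)))"
    by (simp add: a_def sum_distrib_left mult.assoc)
  ultimately show ?thesis by (simp only: I_def[abs_def] C_def)
qed

lemma double_Riemann_sum_tendsto:
  fixes F :: "real \<Rightarrow> real \<Rightarrow> real"
  assumes "\<And>x y t. \<bar>F x t - F y t\<bar> \<le> L * \<bar>x - y\<bar>"
    and "\<And>x y s. \<bar>F s x - F s y\<bar> \<le> L * \<bar>x - y\<bar>"
    and "\<And>s t. \<bar>F s t\<bar> \<le> M" and "0 < c"
  shows "((\<lambda>(m, n). (\<Sum>q=1..n. \<Sum>p=1..m. F (real q * c / real (Suc n)) (real p * c / real (Suc m))) /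
      (real m * real n)) \<longlongrightarrow> integral {0..c} (\<lambda>s. integral {0..c} (F s)) / c\<^sup>2) (at_top \<times>\<^sub>F at_top)"
proof -
  let ?S = "\<lambda>x :: nat \<times> nat. \<Sum>q=1..snd x. \<Sum>p=1..fst x. F (real q * c / real (Suc (snd x))) (real p * c / real (Suc (fst x)))"
  let ?J = "integral {0..c} (\<lambda>s. integral {0..c} (F s))"
  let ?h = "\<lambda>k. c / real (Suc k)"
  define D where "D = c * (L * c\<^sup>2 + M * c)"
  have fst: "filterlim fst at_top (at_top \<times>\<^sub>F at_top :: (nat \<times> nat) filter)"
    and snd: "filterlim snd at_top (at_top \<times>\<^sub>F at_top :: (nat \<times> nat) filter)"
    by (rule filterlim_fst filterlim_snd)+
  have lim0: "(\<lambda>k. D / real (Suc k)) \<longlonglongrightarrow> 0"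
    by (intro lim_const_over_n LIMSEQ_Suc)
  have "((\<lambda>x. ?h (snd x) * ?h (fst x) * ?S x - ?J) \<longlongrightarrow> 0) (at_top \<times>\<^sub>F at_top)"
  proof (rule Lim_null_comparison)
    show "\<forall>\<^sub>F x in at_top \<times>\<^sub>F at_top. norm (?h (snd x) * ?h (fst x) * ?S x - ?J) \<le>
        D / real (Suc (fst x)) + D / real (Suc (snd x))"
    proof (rule always_eventually, rule allI)
      fix x :: "nat \<times> nat"
      show "norm (?h (snd x) * ?h (fst x) * ?S x - ?J) \<le> D / real (Suc (fst x)) + D / real (Suc (snd x))"
        unfolding real_norm_def D_def
        by (rule double_Riemann_sum_error[OF assms(1-3)]) (use assms(4) in simp)
    qed
    have "((\<lambda>x. D / real (Suc (fst x)) + D / real (Suc (snd x))) \<longlongrightarrow> 0 + 0) (at_top \<times>\<^sub>F at_top)"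
      by (intro tendsto_add filterlim_compose[OF lim0 fst] filterlim_compose[OF lim0 snd])
    then show "((\<lambda>x. D / real (Suc (fst x)) + D / real (Suc (snd x))) \<longlongrightarrow> 0) (at_top \<times>\<^sub>F at_top)" by simp
  qed
  then have R: "((\<lambda>x. ?h (snd x) * ?h (fst x) * ?S x) \<longlongrightarrow> ?J) (at_top \<times>\<^sub>F at_top)"
    by (simp only: LIM_zero_iff)
  have "(\<lambda>k. 1 + 1 / real k) \<longlonglongrightarrow> 1 + 0" by (intro tendsto_intros lim_const_over_n)
  then have one: "(\<lambda>k. 1 + 1 / real k) \<longlonglongrightarrow> 1" by simp
  \<comment> \<open>The correcting factors tend to 1 and turn the normalisation by (m+1)(n+1),
    natural for the Riemann sum, into the number mn of vertices.\<close>
  have "((\<lambda>x. ?h (snd x) * ?h (fst x) * ?S x * ((1 + 1 / real (fst x)) * (1 + 1 / real (snd x))) / c\<^sup>2)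
    \<longlongrightarrow> ?J * (1 * 1) / c\<^sup>2) (at_top \<times>\<^sub>F at_top)"
    using assms(4)
    by (intro tendsto_divide tendsto_mult R tendsto_const filterlim_compose[OF one fst] filterlim_compose[OF one snd]) simp
  then have "((\<lambda>x. ?h (snd x) * ?h (fst x) * ?S x * ((1 + 1 / real (fst x)) * (1 + 1 / real (snd x))) / c\<^sup>2)
    \<longlongrightarrow> ?J / c\<^sup>2) (at_top \<times>\<^sub>F at_top)" by simp
  moreover have "\<forall>\<^sub>F x in at_top \<times>\<^sub>F at_top. ?h (snd x) * ?h (fst x) * ?S x * ((1 + 1 / real (fst x)) * (1 + 1 / real (snd x))) / c\<^sup>2
    = ?S x / (real (fst x) * real (snd x))"
  proof -
    have "\<forall>\<^sub>F x :: nat \<times> nat in at_top \<times>\<^sub>F at_top. 0 < fst x"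
      by (rule eventually_compose_filterlim[OF eventually_gt_at_top fst])
    moreover have "\<forall>\<^sub>F x :: nat \<times> nat in at_top \<times>\<^sub>F at_top. 0 < snd x"
      by (rule eventually_compose_filterlim[OF eventually_gt_at_top snd])
    ultimately show ?thesis
    proof eventually_elim
      case (elim x)
      have *: "?h k * (1 + 1 / real k) = c / real k" if "0 < k" for k
      proof -
        have "1 + 1 / real k = real (Suc k) / real k" using that by (simp add: field_simps)
        then show ?thesis by (simp del: of_nat_Suc)
      qed
      have "?h (snd x) * ?h (fst x) * ?S x * ((1 + 1 / real (fst x)) * (1 + 1 / real (snd x))) / c\<^sup>2 =
        (?h (snd x) * (1 + 1 / real (snd x))) * (?h (fst x) * (1 + 1 / real (fst x))) * ?S x / c\<^sup>2"
        by (simp only: mult_ac)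
      also have "\<dots> = ?S x / (real (fst x) * real (snd x))"
        unfolding *[OF elim(1)] *[OF elim(2)] using assms(4) by (simp add: power2_eq_square mult.commute)
      finally show ?case .
    qed
  qed
  ultimately show ?thesis
    by (simp add: case_prod_unfold tendsto_cong)
qed

text \<open>Reflection at the origin followed by a shift by \<open>2 * c\<close> maps the right half
  of the interval onto the left half.\<close>

lemma integral_symmetric:
  fixes g :: "real \<Rightarrow> real"
  assumes "continuous_on UNIV g" "\<And>x. g (2 * c - x) = g x" "0 \<le> c"
  shows "integral {0..2 * c} g = 2 * integral {0..c} g"
proof -
  have cont: "continuous_on A g" for A using assms(1) continuous_on_subset by blast
  have "integral {c..2 * c} g = integral {-(2 * c)..-c} (\<lambda>x. g (- x))"
    by (rule Henstock_Kurzweil_Integration.integral_reflect_real[symmetric])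
  also have "\<dots> = integral {-(2 * c)..-c} (g \<circ> (\<lambda>x. x + 2 * c))"
    using assms(2)[of "- x" for x] by (simp add: comp_def add.commute)
  also have "\<dots> = integral {-(2 * c) + 2 * c..-c + 2 * c} g"
    by (rule integral_shift[OF cont])
  finally have "integral {c..2 * c} g = integral {0..c} g" by simp
  moreover have "integral {0..c} g + integral {c..2 * c} g = integral {0..2 * c} g"
    using assms(3) by (intro Henstock_Kurzweil_Integration.integral_combine) (auto intro!: integrable_continuous_interval cont)
  ultimately show ?thesis by simp
qed

lemma abs_ln_diff_le:
  fixes x y c :: real
  assumes "0 < c" "c \<le> x" "c \<le> y"
  shows "\<bar>ln x - ln y\<bar> \<le> \<bar>x - y\<bar> / c"
proof -
  have "ln u - ln v \<le> \<bar>u - v\<bar> / c" if "c \<le> u" "c \<le> v" for u v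
  proof -
    have "ln u - ln v \<le> (u - v) / v" using that assms(1) by (intro ln_diff_le) auto
    also have "\<dots> \<le> \<bar>u - v\<bar> / v" using that assms(1) by (intro divide_right_mono) auto
    also have "\<dots> \<le> \<bar>u - v\<bar> / c" using that assms(1) by (intro divide_left_mono) auto
    finally show ?thesis .
  qed
  from this[OF assms(2,3)] this[OF assms(3,2)] show ?thesis by (simp add: abs_minus_commute abs_le_iff)
qed

lemma abs_cos_square_diff_le: "\<bar>(cos x)\<^sup>2 - (cos y)\<^sup>2\<bar> \<le> 2 * \<bar>x - y\<bar>" for x y :: real
proof -
  have "\<bar>cos x - cos y\<bar> = 2 * \<bar>sin ((x + y) / 2)\<bar> * \<bar>sin ((y - x) / 2)\<bar>"
    by (simp add: cos_diff_cos abs_mult)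
  also have "\<dots> \<le> 2 * 1 * \<bar>(y - x) / 2\<bar>"
    by (intro mult_mono abs_sin_x_le_abs_x) auto
  finally have "\<bar>cos x - cos y\<bar> \<le> \<bar>x - y\<bar>" by (simp add: abs_minus_commute)
  moreover have "\<bar>cos x + cos y\<bar> \<le> 2" using abs_cos_le_one[of x] abs_cos_le_one[of y] by linarith
  ultimately have "\<bar>cos x + cos y\<bar> * \<bar>cos x - cos y\<bar> \<le> 2 * \<bar>x - y\<bar>" by (intro mult_mono) auto
  then show ?thesis by (simp add: power2_eq_square square_diff_square_factored abs_mult)
qed

section \<open>The free energy\<close>

text \<open>As \<open>ln\<close> is a total function, the first conjunct certifies that the
  logarithm in the limit is the genuine one.\<close>

theorem mainTheorem6:
  fixes a b z :: real
  assumes "a > 0" and "b > 0" and "z > 0"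
  shows "(\<forall>m n. even m \<and> even n \<longrightarrow> grid_partition a b z m n > 0) \<and>
    ((\<lambda>(m, n). ln (grid_partition a b z m n) / (real m * real n)) \<longlongrightarrow>
      2 / pi\<^sup>2 * integral {0..pi/2} (\<lambda>\<theta>. integral {0..pi/2} (\<lambda>\<phi>.
        ln (z\<^sup>2 + 4 * a\<^sup>2 * (cos \<theta>)\<^sup>2 + 4 * b\<^sup>2 * (cos \<phi>)\<^sup>2)))) even_sizes_at_top"
proof
  have pos: "grid_partition a b z m n > 0" for m n
    using set_det_grid_matrix_pos[OF assms(3)] by (simp add: grid_partition_eq_set_det)
  then show "\<forall>m n. even m \<and> even n \<longrightarrow> grid_partition a b z m n > 0" by blast
  define E where "E s t = z\<^sup>2 + 4 * a\<^sup>2 * (cos s)\<^sup>2 + 4 * b\<^sup>2 * (cos t)\<^sup>2" for s t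
  define F where "F s t = ln (E s t)" for s t
  have E_ge: "z\<^sup>2 \<le> E s t" for s t by (simp add: E_def)
  have E_pos: "0 < E s t" for s t using E_ge[of s t] assms(3) by (smt (verit) zero_less_power)
  have E_le: "E s t \<le> z\<^sup>2 + 4 * a\<^sup>2 + 4 * b\<^sup>2" for s t
  proof -
    have "(cos s)\<^sup>2 \<le> 1" "(cos t)\<^sup>2 \<le> 1" by (simp_all add: abs_square_le_1)
    then have "4 * a\<^sup>2 * (cos s)\<^sup>2 \<le> 4 * a\<^sup>2 * 1" "4 * b\<^sup>2 * (cos t)\<^sup>2 \<le> 4 * b\<^sup>2 * 1"
      by (intro mult_left_mono; simp)+
    then show ?thesis by (simp add: E_def)
  qed
  \<comment> \<open>The squared cosine is Lipschitz with constant 2 and carries a coefficient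
    \<open>4 * a\<^sup>2\<close> or \<open>4 * b\<^sup>2\<close>; the logarithm has Lipschitz
    constant \<open>1 / z\<^sup>2\<close> on the range of \<open>E\<close>. The sum
    \<open>a\<^sup>2 + b\<^sup>2\<close> serves both variables at once.\<close>
  define L where "L = 8 * (a\<^sup>2 + b\<^sup>2) / z\<^sup>2"
  have lip: "\<bar>F s t - F s' t'\<bar> \<le> L * d" if "\<bar>E s t - E s' t'\<bar> \<le> 8 * (a\<^sup>2 + b\<^sup>2) * d" for s t s' t' d
  proof -
    have "\<bar>F s t - F s' t'\<bar> \<le> \<bar>E s t - E s' t'\<bar> / z\<^sup>2"
      unfolding F_def using assms(3) by (intro abs_ln_diff_le E_ge) simp
    also have "\<dots> \<le> 8 * (a\<^sup>2 + b\<^sup>2) * d / z\<^sup>2" using that by (intro divide_right_mono) auto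
    finally show ?thesis by (simp add: L_def)
  qed
  have diff: "k * \<bar>(cos x)\<^sup>2 - (cos y)\<^sup>2\<bar> \<le> k * (2 * \<bar>x - y\<bar>)" if "0 \<le> k" for k x y :: real
    using that by (intro mult_left_mono abs_cos_square_diff_le)
  have lip1: "\<bar>F x t - F y t\<bar> \<le> L * \<bar>x - y\<bar>" for x y t
  proof (rule lip)
    have "\<bar>E x t - E y t\<bar> = 4 * a\<^sup>2 * \<bar>(cos x)\<^sup>2 - (cos y)\<^sup>2\<bar>"
      by (simp add: E_def abs_mult flip: right_diff_distrib)
    also have "\<dots> \<le> 4 * a\<^sup>2 * (2 * \<bar>x - y\<bar>)" by (intro diff) simp
    also have "\<dots> \<le> 8 * (a\<^sup>2 + b\<^sup>2) * \<bar>x - y\<bar>" by (simp add: algebra_simps)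
    finally show "\<bar>E x t - E y t\<bar> \<le> 8 * (a\<^sup>2 + b\<^sup>2) * \<bar>x - y\<bar>" .
  qed
  have lip2: "\<bar>F s x - F s y\<bar> \<le> L * \<bar>x - y\<bar>" for x y s
  proof (rule lip)
    have "\<bar>E s x - E s y\<bar> = 4 * b\<^sup>2 * \<bar>(cos x)\<^sup>2 - (cos y)\<^sup>2\<bar>"
      by (simp add: E_def abs_mult flip: right_diff_distrib)
    also have "\<dots> \<le> 4 * b\<^sup>2 * (2 * \<bar>x - y\<bar>)" by (intro diff) simp
    also have "\<dots> \<le> 8 * (a\<^sup>2 + b\<^sup>2) * \<bar>x - y\<bar>" by (simp add: algebra_simps)
    finally show "\<bar>E s x - E s y\<bar> \<le> 8 * (a\<^sup>2 + b\<^sup>2) * \<bar>x - y\<bar>" .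
  qed
  have bound: "\<bar>F s t\<bar> \<le> \<bar>ln (z\<^sup>2)\<bar> + \<bar>ln (z\<^sup>2 + 4 * a\<^sup>2 + 4 * b\<^sup>2)\<bar>" for s t
  proof -
    have "ln (z\<^sup>2) \<le> F s t" unfolding F_def using assms(3) E_pos E_ge by (subst ln_le_cancel_iff) auto
    moreover have "F s t \<le> ln (z\<^sup>2 + 4 * a\<^sup>2 + 4 * b\<^sup>2)"
      unfolding F_def using E_pos[of s t] E_le[of s t] by (subst ln_le_cancel_iff) linarith+
    ultimately show ?thesis by linarith
  qed
  have ln_Z: "2 * ln (grid_partition a b z m n) =
    (\<Sum>q=1..n. \<Sum>p=1..m. F (real q * pi / real (Suc n)) (real p * pi / real (Suc m)))" for m n
  proof -
    have "2 * ln (grid_partition a b z m n) = ln ((grid_partition a b z m n)\<^sup>2)"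
      using pos by (simp add: ln_realpow)
    also have "\<dots> = ln (\<Prod>(p, q)\<in>{1..m} \<times> {1..n}. E (real q * pi / real (Suc n)) (real p * pi / real (Suc m)))"
      unfolding grid_partition_eq_set_det set_det_grid_matrix_square E_def by (simp add: case_prod_beta)
    also have "\<dots> = (\<Sum>(p, q)\<in>{1..m} \<times> {1..n}. F (real q * pi / real (Suc n)) (real p * pi / real (Suc m)))"
      by (subst ln_prod) (auto simp: F_def case_prod_beta E_pos less_imp_neq[symmetric] intro!: sum.cong)
    also have "\<dots> = (\<Sum>q=1..n. \<Sum>p=1..m. F (real q * pi / real (Suc n)) (real p * pi / real (Suc m)))"
      by (subst sum.swap) (simp add: sum.cartesian_product)
    finally show ?thesis .
  qed
  let ?J = "\<lambda>c. integral {0..c} (\<lambda>s. integral {0..c} (F s))"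
  have "((\<lambda>(m, n). 2 * ln (grid_partition a b z m n) / (real m * real n)) \<longlongrightarrow> ?J pi / pi\<^sup>2) (at_top \<times>\<^sub>F at_top)"
    unfolding ln_Z by (rule double_Riemann_sum_tendsto[OF lip1 lip2 bound pi_gt_zero])
  then have "((\<lambda>x. (case x of (m, n) \<Rightarrow> 2 * ln (grid_partition a b z m n) / (real m * real n)) / 2) \<longlongrightarrow> ?J pi / pi\<^sup>2 / 2) (at_top \<times>\<^sub>F at_top)"
    by (intro tendsto_divide tendsto_const) auto
  then have "((\<lambda>(m, n). ln (grid_partition a b z m n) / (real m * real n)) \<longlongrightarrow> ?J pi / pi\<^sup>2 / 2) (at_top \<times>\<^sub>F at_top)"
    by (simp add: case_prod_unfold)
  then have lim: "((\<lambda>(m, n). ln (grid_partition a b z m n) / (real m * real n)) \<longlongrightarrow> ?J pi / pi\<^sup>2 / 2) even_sizes_at_top"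
    unfolding even_sizes_at_top_def by (rule tendsto_mono[OF inf_le1])
  have sym: "integral {0..pi} g = 2 * integral {0..pi/2} g"
    if "continuous_on UNIV g" "\<And>x. g (pi - x) = g x" for g :: "real \<Rightarrow> real"
    using integral_symmetric[of g "pi / 2"] that by simp
  have cont: "continuous_on UNIV (F s)" for s
    unfolding F_def E_def using E_pos[unfolded E_def] less_imp_neq[symmetric]
    by (intro continuous_intros) auto
  have "?J pi = 2 * integral {0..pi/2} (\<lambda>s. integral {0..pi} (F s))"
  proof (rule sym)
    show "continuous_on UNIV (\<lambda>s. integral {0..pi} (F s))"
    proof (rule lipschitz_on_continuous_on[of "L * pi"])
      show "(L * pi)-lipschitz_on UNIV (\<lambda>s. integral {0..pi} (F s))"
      proof (rule lipschitz_onI)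
        fix x y
        have c: "continuous_on {0..pi} (F s)" for s using cont continuous_on_subset by blast
        have "integral {0..pi} (F x) - integral {0..pi} (F y) = integral {0..pi} (\<lambda>t. F x t - F y t)"
          by (rule integral_diff[symmetric]) (auto intro!: integrable_continuous_interval c)
        moreover have "norm (integral {0..pi} (\<lambda>t. F x t - F y t)) \<le> L * \<bar>x - y\<bar> * (pi - 0)"
          using lip1 by (intro integral_bound) (auto intro!: continuous_intros c)
        ultimately show "dist (integral {0..pi} (F x)) (integral {0..pi} (F y)) \<le> L * pi * dist x y"
          by (simp add: dist_real_def mult_ac)
      qed (simp add: L_def)
    qed
    show "integral {0..pi} (F (pi - x)) = integral {0..pi} (F x)" for x
      by (simp add: F_def[abs_def] E_def)
  qed
  moreover have "(\<lambda>s. integral {0..pi} (F s)) = (\<lambda>s. 2 * integral {0..pi/2} (F s))"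
    by (intro ext sym cont) (simp add: F_def E_def)
  then have "integral {0..pi/2} (\<lambda>s. integral {0..pi} (F s)) = 2 * ?J (pi / 2)" by simp
  \<comment> \<open>Folding both variables at pi/2 gives a factor 4, and the square in the product
    formula a factor 1/2.\<close>
  ultimately have "?J pi / pi\<^sup>2 / 2 = 2 / pi\<^sup>2 * ?J (pi / 2)" by (simp only:) simp
  then show "((\<lambda>(m, n). ln (grid_partition a b z m n) / (real m * real n)) \<longlongrightarrow>
      2 / pi\<^sup>2 * integral {0..pi/2} (\<lambda>\<theta>. integral {0..pi/2} (\<lambda>\<phi>.
        ln (z\<^sup>2 + 4 * a\<^sup>2 * (cos \<theta>)\<^sup>2 + 4 * b\<^sup>2 * (cos \<phi>)\<^sup>2)))) even_sizes_at_top"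
    using lim by (simp add: F_def[abs_def] E_def)
qed

end
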